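(* For every $A\ge 1$ there exists a constant $C=C(A)\ge 1$, depending only on $A$, such that the following holds for every (Euclidean) inner $A$-uniform domain $\Omega\subset\mathbb C$. (1) The complementary components of $\Omega$ are uniformly relatively separated: for every pair of distinct components $S_1,S_2$ of $\mathbb C\setminus\Omega$, $\min\{\operatorname{diam}S_1,\operatorname{diam}S_2\}\le C\operatorname{dist}(S_1,S_2)$. (2) The complementary components of $\Omega$ have uniformly bounded turning: each component of $\mathbb C\setminus\Omega$ has $C$-bounded turning. (3) If $\Omega$ contains a neighborhood of $\infty$, there exists a sequence $\{\Omega_n\}_{n\in\mathbb N}$ of finitely connected domains in $\mathbb C$ that are inner $C$-uniform (with the same constant $C$ for all $n$), such that $\Omega\subset\Omega_{n+1}\subset\Omega_n$ for each $n\in\mathbb N$ and $\left(\bigcap_{n\in\mathbb N}\Omega_n\right)\setminus\Omega$ is a totally disconnected set.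
   Context: All metric notions are Euclidean. $\ell(\gamma)$ is the length of a curve $\gamma$. For a domain $\Omega\subset\mathbb C=\mathbb R^2$ and $a,b\in\Omega$, $\lambda_\Omega(a,b)$ is the infimum of $\ell(\gamma)$ over all paths $\gamma$ in $\Omega$ connecting $a$ and $b$. For $A\ge1$, $\Omega$ is inner $A$-uniform if every pair $a,b\in\Omega$ can be joined by a curve $\gamma:[0,1]\to\Omega$ with $\gamma(0)=a$, $\gamma(1)=b$, $\ell(\gamma)\le A\lambda_\Omega(a,b)$ and $\min\{\ell(\gamma|_{[0,t]}),\ell(\gamma|_{[t,1]})\}\le A\operatorname{dist}(\gamma(t),\partial\Omega)$ for all $t\in[0,1]$ (equivalently, $B(\gamma(t),A^{-1}\min\{\ell(\gamma|_{[0,t]}),\ell(\gamma|_{[t,1]})\})\subset\Omega$ for all $t$). A metric space $(X,d_X)$ has $L$-bounded turning ($L\geq 1$) if for each $x,y\in X$ there is a connected set $E\subset X$ containing $x,y$ with $\operatorname{diam}E\le L\,d_X(x,y)$; subsets of $\mathbb C$ carry the Euclidean metric. A neighborhood of $\infty$ is an open subset of the plane that contains the exterior of a ball. A domain is finitely connected if its complement has finitely many components. Unbounded sets have infinite diameter. *)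

theory Defs
  imports "HOL-Analysis.Analysis"
begin

(* Lengths, diameters and distances to the boundary take values in ennreal: the real-valued
   diameter and infdist of the library are 0 for unbounded and for empty sets respectively,
   which is not the intended convention here. *)

definition curve_length :: "(real \<Rightarrow> 'a::metric_space) \<Rightarrow> real \<Rightarrow> real \<Rightarrow> ennreal" where
  "curve_length \<gamma> a b =
     (SUP (n, t) \<in> {(n :: nat, t :: nat \<Rightarrow> real). t 0 = a \<and> t n = b \<and> mono_on {..n} t}.
        \<Sum>i<n. ennreal (dist (\<gamma> (t i)) (\<gamma> (t (Suc i)))))"

definition ediameter :: "'a::metric_space set \<Rightarrow> ennreal" where
  "ediameter S = (SUP x\<in>S. SUP y\<in>S. ennreal (dist x y))"

definition plane_domain :: "complex set \<Rightarrow> bool" where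
  "plane_domain \<Omega> \<longleftrightarrow> open \<Omega> \<and> connected \<Omega> \<and> \<Omega> \<noteq> {}"

definition joins_in :: "complex set \<Rightarrow> complex \<Rightarrow> complex \<Rightarrow> (real \<Rightarrow> complex) \<Rightarrow> bool" where
  "joins_in \<Omega> a b \<gamma> \<longleftrightarrow>
     path \<gamma> \<and> path_image \<gamma> \<subseteq> \<Omega> \<and> pathstart \<gamma> = a \<and> pathfinish \<gamma> = b"

definition inner_dist :: "complex set \<Rightarrow> complex \<Rightarrow> complex \<Rightarrow> ennreal" where
  "inner_dist \<Omega> a b = (INF \<gamma> \<in> Collect (joins_in \<Omega> a b). curve_length \<gamma> 0 1)"

(* Infinite for the whole plane, whose frontier is empty; this agrees with the formulation
   of inner uniformity through balls contained in the domain. *)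
definition boundary_dist :: "complex set \<Rightarrow> complex \<Rightarrow> ennreal" where
  "boundary_dist \<Omega> z = (INF w \<in> frontier \<Omega>. ennreal (dist z w))"

definition inner_uniform :: "real \<Rightarrow> complex set \<Rightarrow> bool" where
  "inner_uniform A \<Omega> \<longleftrightarrow> A \<ge> 1 \<and> plane_domain \<Omega> \<and>
     (\<forall>a\<in>\<Omega>. \<forall>b\<in>\<Omega>. \<exists>\<gamma>. joins_in \<Omega> a b \<gamma> \<and>
        curve_length \<gamma> 0 1 \<le> ennreal A * inner_dist \<Omega> a b \<and>
        (\<forall>t\<in>{0..1}. min (curve_length \<gamma> 0 t) (curve_length \<gamma> t 1)
                       \<le> ennreal A * boundary_dist \<Omega> (\<gamma> t)))"

definition bounded_turning :: "real \<Rightarrow> 'a::metric_space set \<Rightarrow> bool" where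
  "bounded_turning L X \<longleftrightarrow> L \<ge> 1 \<and>
     (\<forall>x\<in>X. \<forall>y\<in>X. \<exists>E\<subseteq>X. connected E \<and> x \<in> E \<and> y \<in> E \<and>
        ediameter E \<le> ennreal L * ennreal (dist x y))"

definition neighborhood_of_infinity :: "complex set \<Rightarrow> bool" where
  "neighborhood_of_infinity U \<longleftrightarrow> open U \<and> (\<exists>c r. r > 0 \<and> - cball c r \<subseteq> U)"

definition finitely_connected_domain :: "complex set \<Rightarrow> bool" where
  "finitely_connected_domain \<Omega> \<longleftrightarrow> plane_domain \<Omega> \<and> finite (components (- \<Omega>))"

definition totally_disconnected :: "'a::topological_space set \<Rightarrow> bool" where
  "totally_disconnected S \<longleftrightarrow> (\<forall>E\<subseteq>S. connected E \<longrightarrow> (\<forall>x\<in>E. \<forall>y\<in>E. x = y))"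

end

theory Submission
  imports Defs "HOL-Complex_Analysis.Riemann_Mapping"
begin

text \<open>
  Let \<open>\<Omega>\<close> be inner \<open>A\<close>-uniform. Two facts about such a domain carry everything. Every point of \<open>\<Omega>\<close> is
  linked, by a curve of length at most \<open>s\<close>, to a roomy point, the centre of a disc of radius \<open>s / A\<close>
  in \<open>\<Omega>\<close>, as soon as \<open>\<Omega>\<close> reaches farther than \<open>3 s\<close> (\<open>roomy_point\<close>). And a uniform curve that comes
  close to a complementary point does so near one of its endpoints, hence never if its endpoints are
  roomy at a larger scale.

  Properties (1) and (2) have a common source, \<open>connected_component_localize\<close>: if \<open>z1\<close> and \<open>z2\<close> are
  complementary points at distance \<open>d\<close> whose complementary components, equal or not, both leave a
  disc of radius comparable to \<open>d\<close>, then \<open>z1\<close> and \<open>z2\<close> lie in one component of the part of the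
  complement in a smaller such disc. Intuitively, if \<open>\<Omega>\<close> passed between \<open>z1\<close> and \<open>z2\<close>, then roomy
  points on the two sides of the gap would be joined by a short curve in \<open>\<Omega>\<close>; the uniform curve
  joining them cannot pass through the gap, and it is too short to go around a component. The
  topological part of the argument is phrased with continuous logarithms: the above would yield
  a logarithm of \<open>(z - z1) / (z - z2)\<close> off a compact set, which is possible only if this set connects
  \<open>z1\<close> with \<open>z2\<close>.

  For (3), by (1) only finitely many complementary components have diameter at least \<open>1 / (n + 1)\<close>;
  the domain \<open>\<Omega>\<^sub>n\<close> arises from \<open>\<Omega>\<close> by filling in all the others. What the
  intersection of these domains contains besides \<open>\<Omega>\<close> are the one-point components. It has to be shown
  that filling components which are small compared with their distance to the set \<open>E\<close> of
  remaining ones preserves inner uniformity (\<open>inner_uniform_filled\<close>). A curve of length \<open>L\<close> in the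
  filled domain that stays within \<open>4 L\<close> of \<open>E\<close> meets only components of diameter at most a multiple of
  \<open>L\<close>. None of them separates \<open>\<Omega>\<close> locally, by Janiszewski's theorem, so the
  endpoints (moved out of the filled components first) lie in a connected part of \<open>\<Omega>\<close> of
  diameter comparable to \<open>L\<close>. A disc of that size contains only a bounded number of roomy points
  at scale \<open>L\<close> that are not obviously linked, so chains of them can be shortened to
  bounded length (\<open>linked_along_connected_set\<close>). This bounds the inner distance in \<open>\<Omega>\<close>
  by a multiple of \<open>L\<close>, and the uniform curve in \<open>\<Omega>\<close> is uniform in the filled domain too.
\<close>

section \<open>Lengths of curves\<close>

lemma curve_length_leI:
  assumes "\<And>n t. t 0 = a \<Longrightarrow> t n = b \<Longrightarrow> mono_on {..n::nat} t \<Longrightarrow>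
             (\<Sum>i<n. ennreal (dist (\<gamma> (t i)) (\<gamma> (t (Suc i))))) \<le> L"
  shows "curve_length \<gamma> a b \<le> L"
  unfolding curve_length_def using assms by (auto intro!: SUP_least)

lemma partition_sum_le_curve_length:
  assumes "t 0 = a" "t n = b" "mono_on {..n::nat} t"
  shows "(\<Sum>i<n. ennreal (dist (\<gamma> (t i)) (\<gamma> (t (Suc i))))) \<le> curve_length \<gamma> a b"
  unfolding curve_length_def using assms by (intro SUP_upper2[of "(n, t)"]) auto

lemma dist_le_curve_length:
  assumes "a \<le> b"
  shows "ennreal (dist (\<gamma> a) (\<gamma> b)) \<le> curve_length \<gamma> a b"
  using partition_sum_le_curve_length[of "\<lambda>i::nat. if i = 0 then a else b" a 1 b \<gamma>] assms
  by (auto simp: mono_on_def)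

lemma curve_length_cong:
  assumes "\<And>t. a \<le> t \<Longrightarrow> t \<le> b \<Longrightarrow> \<gamma> t = \<delta> t"
  shows "curve_length \<gamma> a b \<le> curve_length \<delta> a b"
proof (rule curve_length_leI)
  fix n t assume t: "t 0 = a" "t n = b" "mono_on {..n::nat} t"
  have "a \<le> t i \<and> t i \<le> b" if "i \<le> n" for i
    using t that by (metis atMost_iff bot_nat_0.extremum mono_onD order_refl)
  then have "(\<Sum>i<n. ennreal (dist (\<gamma> (t i)) (\<gamma> (t (Suc i)))))
      = (\<Sum>i<n. ennreal (dist (\<delta> (t i)) (\<delta> (t (Suc i)))))"
    by (intro sum.cong) (auto simp: assms)
  then show "(\<Sum>i<n. ennreal (dist (\<gamma> (t i)) (\<gamma> (t (Suc i))))) \<le> curve_length \<delta> a b"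
    using partition_sum_le_curve_length[OF t] by simp
qed

lemma curve_length_comp_mono:
  assumes "mono_on {a..b} \<phi>"
  shows "curve_length (\<gamma> \<circ> \<phi>) a b \<le> curve_length \<gamma> (\<phi> a) (\<phi> b)"
proof (rule curve_length_leI)
  fix n t assume t: "t 0 = a" "t n = b" "mono_on {..n::nat} t"
  have bd: "a \<le> t i \<and> t i \<le> b" if "i \<le> n" for i
    using t that by (metis atMost_iff bot_nat_0.extremum mono_onD order_refl)
  have "mono_on {..n} (\<phi> \<circ> t)"
    using assms t(3) bd unfolding mono_on_def by auto
  from partition_sum_le_curve_length[OF _ _ this, of "\<phi> a" "\<phi> b" \<gamma>] t
  show "(\<Sum>i<n. ennreal (dist ((\<gamma> \<circ> \<phi>) (t i)) ((\<gamma> \<circ> \<phi>) (t (Suc i))))) \<le> curve_length \<gamma> (\<phi> a) (\<phi> b)"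
    by simp
qed

lemma curve_length_reverse:
  "curve_length (\<lambda>t. \<gamma> (c - t)) a b \<le> curve_length \<gamma> (c - b) (c - a)"
proof (rule curve_length_leI)
  fix n t assume t: "t 0 = a" "t n = b" "mono_on {..n::nat} t"
  let ?u = "\<lambda>i. c - t (n - i)"
  have "mono_on {..n} ?u"
    using t(3) unfolding mono_on_def by auto
  from partition_sum_le_curve_length[OF _ _ this, of "c - b" "c - a" \<gamma>] t
  have "(\<Sum>i<n. ennreal (dist (\<gamma> (?u i)) (\<gamma> (?u (Suc i))))) \<le> curve_length \<gamma> (c - b) (c - a)"
    by simp
  also have "(\<Sum>i<n. ennreal (dist (\<gamma> (?u i)) (\<gamma> (?u (Suc i)))))
      = (\<Sum>i<n. ennreal (dist (\<gamma> (c - t i)) (\<gamma> (c - t (Suc i)))))"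
    by (rule sum.reindex_bij_witness[of _ "\<lambda>i. n - Suc i" "\<lambda>i. n - Suc i"])
       (auto simp: dist_commute Suc_diff_Suc)
  finally show "(\<Sum>i<n. ennreal (dist (\<gamma> (c - t i)) (\<gamma> (c - t (Suc i))))) \<le> curve_length \<gamma> (c - b) (c - a)" .
qed

text \<open>A partition of the longer interval is cut at the intermediate point by truncating its
  points from above and from below.\<close>
lemma curve_length_subadditive:
  assumes "a \<le> b" "b \<le> c"
  shows "curve_length \<gamma> a c \<le> curve_length \<gamma> a b + curve_length \<gamma> b c"
proof (rule curve_length_leI)
  fix n t assume t: "t 0 = a" "t n = c" "mono_on {..n::nat} t"
  let ?d = "\<lambda>u i. ennreal (dist (\<gamma> (u i)) (\<gamma> (u (Suc i))))"
  let ?l = "\<lambda>i. min (t i) b" and ?r = "\<lambda>i. max (t i) b"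
  have "?d t i \<le> ?d ?l i + ?d ?r i" if "i < n" for i
  proof -
    have "t i \<le> t (Suc i)"
      using t(3) that unfolding mono_on_def by auto
    then have "dist (\<gamma> (t i)) (\<gamma> (t (Suc i)))
        \<le> dist (\<gamma> (?l i)) (\<gamma> (?l (Suc i))) + dist (\<gamma> (?r i)) (\<gamma> (?r (Suc i)))"
      by (auto simp: min_def max_def dist_triangle)
    then show ?thesis
      by (metis ennreal_leI ennreal_plus zero_le_dist)
  qed
  then have "(\<Sum>i<n. ?d t i) \<le> (\<Sum>i<n. ?d ?l i + ?d ?r i)"
    by (intro sum_mono) auto
  also have "\<dots> = (\<Sum>i<n. ?d ?l i) + (\<Sum>i<n. ?d ?r i)"
    by (rule sum.distrib)
  also have "(\<Sum>i<n. ?d ?l i) \<le> curve_length \<gamma> a b"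
    using t assms by (intro partition_sum_le_curve_length) (auto simp: mono_on_def min_def intro: order_trans)
  also have "(\<Sum>i<n. ?d ?r i) \<le> curve_length \<gamma> b c"
    using t assms by (intro partition_sum_le_curve_length) (auto simp: mono_on_def max_def intro: order_trans)
  finally show "(\<Sum>i<n. ?d t i) \<le> curve_length \<gamma> a b + curve_length \<gamma> b c"
    by (auto intro: add_mono)
qed

lemma curve_length_mono:
  assumes "a' \<le> a" "a \<le> b" "b \<le> b'"
  shows "curve_length \<gamma> a b \<le> curve_length \<gamma> a' b'"
proof (rule curve_length_leI)
  fix n t assume t: "t 0 = a" "t n = b" "mono_on {..n::nat} t"
  let ?d = "\<lambda>u i. ennreal (dist (\<gamma> (u i)) (\<gamma> (u (Suc i))))"
  define u where "u i = (if i = 0 then a' else if i \<le> Suc n then t (i - 1) else b')" for i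
  have bd: "a \<le> t i \<and> t i \<le> b" if "i \<le> n" for i
    using t that by (metis atMost_iff bot_nat_0.extremum mono_onD order_refl)
  have bd': "a' \<le> t (i - 1) \<and> t (i - 1) \<le> b'" if "i \<le> Suc n" for i
  proof -
    have "i - 1 \<le> n" using that by linarith
    from bd[OF this] show ?thesis using assms by linarith
  qed
  have "mono_on {..Suc (Suc n)} u"
  proof (rule mono_onI)
    fix i j assume ij: "i \<in> {..Suc (Suc n)}" "j \<in> {..Suc (Suc n)}" "i \<le> j"
    have "t (i - 1) \<le> t (j - 1)" if "j \<le> Suc n"
      by (rule mono_onD[OF t(3)]) (use that ij in auto)
    then show "u i \<le> u j"
      using ij bd'[of i] bd'[of j] \<open>a' \<le> a\<close> \<open>a \<le> b\<close> \<open>b \<le> b'\<close> by (auto simp: u_def)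
  qed
  from partition_sum_le_curve_length[OF _ _ this, of a' b' \<gamma>]
  have "(\<Sum>i<Suc (Suc n). ?d u i) \<le> curve_length \<gamma> a' b'"
    by (simp add: u_def)
  moreover have "(\<Sum>i<n. ?d t i) = (\<Sum>i<n. ?d u (Suc i))"
    by (intro sum.cong) (auto simp: u_def)
  moreover have "(\<Sum>i<Suc (Suc n). ?d u i) = ?d u 0 + ((\<Sum>i<n. ?d u (Suc i)) + ?d u (Suc n))"
    by (subst sum.lessThan_Suc_shift) simp
  ultimately show "(\<Sum>i<n. ?d t i) \<le> curve_length \<gamma> a' b'"
    by (metis (no_types, lifting) add_increasing le_iff_add order_trans zero_le)
qed

text \<open>Lower semicontinuity: the sum over a partition of \<open>[a, b]\<close> is the limit, as \<open>\<tau>\<close> increases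
  to \<open>b\<close>, of the sums over the partition truncated at \<open>\<tau>\<close>.\<close>
lemma curve_length_le_left_limit:
  fixes \<gamma> :: "real \<Rightarrow> 'a::metric_space"
  assumes cont: "continuous_on {a..b} \<gamma>" and "a < b"
    and le: "\<And>\<tau>. a \<le> \<tau> \<Longrightarrow> \<tau> < b \<Longrightarrow> curve_length \<gamma> a \<tau> \<le> ennreal s" and "0 \<le> s"
  shows "curve_length \<gamma> a b \<le> ennreal s"
proof (rule curve_length_leI)
  fix n t assume t: "t 0 = a" "t n = b" "mono_on {..n::nat} t"
  have bd: "a \<le> t i \<and> t i \<le> b" if "i \<le> n" for i
    using t that by (metis atMost_iff bot_nat_0.extremum mono_onD order_refl)
  let ?S = "\<lambda>\<tau>. \<Sum>i<n. dist (\<gamma> (min (t i) \<tau>)) (\<gamma> (min (t (Suc i)) \<tau>))"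
  have sm: "?S \<tau> \<le> s" if "a \<le> \<tau>" "\<tau> < b" for \<tau>
  proof -
    have "mono_on {..n} (\<lambda>i. min (t i) \<tau>)"
      using t(3) unfolding mono_on_def by (auto intro: min.coboundedI1)
    from partition_sum_le_curve_length[OF _ _ this, of a \<tau> \<gamma>]
    have "ennreal (?S \<tau>) \<le> curve_length \<gamma> a \<tau>"
      using t that by (simp add: sum_ennreal)
    then show ?thesis
      using le[OF that] \<open>0 \<le> s\<close> by (metis ennreal_le_iff order_trans)
  qed
  have "continuous_on {a..b} (\<lambda>\<tau>. \<gamma> (min (t i) \<tau>))" if "i \<le> n" for i
    by (rule continuous_on_compose2[OF cont]) (use bd[OF that] in \<open>auto intro!: continuous_intros\<close>)
  then have "continuous_on {a..b} ?S"
    by (intro continuous_intros) auto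
  then have "(?S \<longlongrightarrow> ?S b) (at_left b)"
    using \<open>a < b\<close> continuous_on_Icc_at_leftD by blast
  moreover have "eventually (\<lambda>\<tau>. ?S \<tau> \<le> s) (at_left b)"
    unfolding eventually_at_left_field by (rule exI[of _ a]) (use \<open>a < b\<close> sm in auto)
  ultimately have "?S b \<le> s"
    by (intro tendsto_upperbound) auto
  moreover have "?S b = (\<Sum>i<n. dist (\<gamma> (t i)) (\<gamma> (t (Suc i))))"
    by (intro sum.cong) (use bd in \<open>auto simp: min_def\<close>)
  ultimately show "(\<Sum>i<n. ennreal (dist (\<gamma> (t i)) (\<gamma> (t (Suc i))))) \<le> ennreal s"
    by (simp add: sum_ennreal \<open>0 \<le> s\<close>)
qed

lemma curve_length_linepath:
  assumes "0 \<le> u" "u \<le> v"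
  shows "curve_length (linepath (a::complex) b) u v \<le> ennreal ((v - u) * dist a b)"
proof (rule curve_length_leI)
  fix n t assume t: "t 0 = u" "t n = v" "mono_on {..n::nat} t"
  have d: "dist (linepath a b x) (linepath a b y) = (y - x) * dist a b" if "x \<le> y" for x y
  proof -
    have "linepath a b x - linepath a b y = (y - x) *\<^sub>R (a - b)"
      by (simp add: linepath_def algebra_simps)
    then show ?thesis
      using that by (simp add: dist_norm)
  qed
  have "t i \<le> t (Suc i)" if "i < n" for i
    using t(3) that unfolding mono_on_def by auto
  then have "(\<Sum>i<n. ennreal (dist (linepath a b (t i)) (linepath a b (t (Suc i)))))
     = (\<Sum>i<n. ennreal ((t (Suc i) - t i) * dist a b))"
    by (intro sum.cong) (auto simp: d)
  also have "\<dots> = ennreal (\<Sum>i<n. (t (Suc i) - t i) * dist a b)"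
    using \<open>\<And>i. i < n \<Longrightarrow> t i \<le> t (Suc i)\<close> by (intro sum_ennreal) auto
  also have "(\<Sum>i<n. (t (Suc i) - t i) * dist a b) = (v - u) * dist a b"
    using t by (simp add: sum_distrib_right[symmetric] sum_lessThan_telescope)
  finally show "(\<Sum>i<n. ennreal (dist (linepath a b (t i)) (linepath a b (t (Suc i))))) \<le> ennreal ((v - u) * dist a b)"
    by simp
qed

lemma curve_length_joinpaths_left:
  assumes "0 \<le> u" "u \<le> v" "v \<le> 1"
  shows "curve_length (g +++ h) (u / 2) (v / 2) \<le> curve_length g u v"
proof -
  have "curve_length (g +++ h) (u / 2) (v / 2) \<le> curve_length (g \<circ> (\<lambda>t. 2 * t)) (u / 2) (v / 2)"
    using assms by (intro curve_length_cong) (auto simp: joinpaths_def)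
  also have "\<dots> \<le> curve_length g (2 * (u / 2)) (2 * (v / 2))"
    by (rule curve_length_comp_mono) (auto simp: mono_on_def)
  finally show ?thesis by simp
qed

lemma curve_length_joinpaths_right:
  assumes "pathfinish g = pathstart h" "0 \<le> u" "u \<le> v" "v \<le> 1"
  shows "curve_length (g +++ h) ((u + 1) / 2) ((v + 1) / 2) \<le> curve_length h u v"
proof -
  have "curve_length (g +++ h) ((u + 1) / 2) ((v + 1) / 2)
     \<le> curve_length (h \<circ> (\<lambda>t. 2 * t - 1)) ((u + 1) / 2) ((v + 1) / 2)"
    using assms by (intro curve_length_cong) (auto simp: joinpaths_def pathstart_def pathfinish_def
        field_simps dest!: antisym)
  also have "\<dots> \<le> curve_length h (2 * ((u + 1) / 2) - 1) (2 * ((v + 1) / 2) - 1)"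
    by (rule curve_length_comp_mono) (auto simp: mono_on_def)
  finally show ?thesis by (simp add: field_simps)
qed

section \<open>Points linked by curves of bounded length\<close>

text \<open>The inner distance is at most \<open>L\<close>, witnessed by a curve, with a real bound: this avoids
  arithmetic with infinite lengths and infima that are not attained.\<close>
definition linked :: "complex set \<Rightarrow> real \<Rightarrow> complex \<Rightarrow> complex \<Rightarrow> bool" where
  "linked \<Omega> L a b \<longleftrightarrow> (\<exists>\<gamma>. joins_in \<Omega> a b \<gamma> \<and> curve_length \<gamma> 0 1 \<le> ennreal L)"

lemma joins_in_join:
  assumes "joins_in \<Omega> a b g" "joins_in \<Omega> b c h"
  shows "joins_in \<Omega> a c (g +++ h)"
  using assms path_image_join_subset[of g h] unfolding joins_in_def by fastforce

lemma curve_length_join_le: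
  assumes "pathfinish g = pathstart h"
  shows "curve_length (g +++ h) 0 1 \<le> curve_length g 0 1 + curve_length h 0 1"
  using curve_length_subadditive[of 0 "1/2" 1 "g +++ h"]
    curve_length_joinpaths_left[of 0 1 g h] curve_length_joinpaths_right[OF assms, of 0 1]
  by (auto intro: order_trans add_mono)

text \<open>This transfers the length condition on uniform curves from the pieces to a concatenation.\<close>
lemma curve_length_join_cases:
  assumes gh: "pathfinish g = pathstart h" and t: "t \<in> {0..1}"
  obtains u where "u \<in> {0..1}" "(g +++ h) t = g u" "curve_length (g +++ h) 0 t \<le> curve_length g 0 u"
      "curve_length (g +++ h) t 1 \<le> curve_length g u 1 + curve_length h 0 1"
  | u where "u \<in> {0..1}" "(g +++ h) t = h u"
      "curve_length (g +++ h) 0 t \<le> curve_length g 0 1 + curve_length h 0 u"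
      "curve_length (g +++ h) t 1 \<le> curve_length h u 1"
proof (cases "t \<le> 1/2")
  case True
  have "curve_length (g +++ h) 0 t \<le> curve_length g 0 (2 * t)"
    using curve_length_joinpaths_left[of 0 "2 * t" g h] True t by simp
  moreover have "curve_length (g +++ h) t 1 \<le> curve_length g (2 * t) 1 + curve_length h 0 1"
    using curve_length_subadditive[of t "1/2" 1 "g +++ h"] True t
      curve_length_joinpaths_left[of "2 * t" 1 g h] curve_length_joinpaths_right[OF gh, of 0 1]
    by (auto intro: order_trans add_mono)
  moreover have "(g +++ h) t = g (2 * t)"
    using True by (simp add: joinpaths_def)
  ultimately show ?thesis
    using that(1)[of "2 * t"] True t by auto
next
  case False
  have "curve_length (g +++ h) t 1 \<le> curve_length h (2 * t - 1) 1"
    using curve_length_joinpaths_right[OF gh, of "2 * t - 1" 1] False t by simp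
  moreover have "curve_length (g +++ h) 0 t \<le> curve_length g 0 1 + curve_length h 0 (2 * t - 1)"
    using curve_length_subadditive[of 0 "1/2" t "g +++ h"] False t
      curve_length_joinpaths_left[of 0 1 g h] curve_length_joinpaths_right[OF gh, of 0 "2 * t - 1"]
    by (auto intro: order_trans add_mono)
  moreover have "(g +++ h) t = h (2 * t - 1)"
    using False by (simp add: joinpaths_def)
  ultimately show ?thesis
    using that(2)[of "2 * t - 1"] False t by auto
qed

lemma joins_in_reverse:
  assumes "joins_in \<Omega> a b g"
  shows "joins_in \<Omega> b a (reversepath g)"
  using assms unfolding joins_in_def by simp

lemma curve_length_reversepath: "curve_length (reversepath g) 0 1 \<le> curve_length g 0 1"
  using curve_length_reverse[of g 1 0 1] by (simp add: reversepath_def)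

lemma linked_sym: "linked \<Omega> L a b \<Longrightarrow> linked \<Omega> L b a"
  unfolding linked_def by (meson curve_length_reversepath joins_in_reverse order_trans)

lemma linked_trans:
  assumes "linked \<Omega> L a b" "linked \<Omega> M b c" "0 \<le> L" "0 \<le> M"
  shows "linked \<Omega> (L + M) a c"
proof -
  obtain g h where g: "joins_in \<Omega> a b g" "curve_length g 0 1 \<le> ennreal L"
    and h: "joins_in \<Omega> b c h" "curve_length h 0 1 \<le> ennreal M"
    using assms unfolding linked_def by blast
  have "curve_length (g +++ h) 0 1 \<le> ennreal L + ennreal M"
    using curve_length_join_le[of g h] g h unfolding joins_in_def
    by (auto intro: order_trans add_mono)
  then show ?thesis
    using joins_in_join[OF g(1) h(1)] assms unfolding linked_def by (auto simp: ennreal_plus)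
qed

lemma linked_mono:
  assumes "linked \<Omega> L a b" "\<Omega> \<subseteq> \<Omega>'" "L \<le> M"
  shows "linked \<Omega>' M a b"
proof -
  obtain \<gamma> where "joins_in \<Omega> a b \<gamma>" "curve_length \<gamma> 0 1 \<le> ennreal L"
    using assms(1) unfolding linked_def by blast
  then show ?thesis
    using assms(2) ennreal_leI[OF assms(3)] unfolding linked_def joins_in_def
    by (intro exI[of _ \<gamma>]) auto
qed

lemma linked_segment:
  assumes "closed_segment a b \<subseteq> \<Omega>" "dist a b \<le> L"
  shows "linked \<Omega> L a b"
proof -
  have "curve_length (linepath a b) 0 1 \<le> ennreal L"
    using curve_length_linepath[of 0 1 a b] assms(2) by (auto intro: order_trans ennreal_leI)
  then show ?thesis
    using assms(1) unfolding linked_def joins_in_def by (intro exI[of _ "linepath a b"]) auto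
qed

lemma linked_refl:
  assumes "a \<in> \<Omega>" "0 \<le> L"
  shows "linked \<Omega> L a a"
  using linked_segment[of a a \<Omega> L] assms by simp

lemma linked_endpoints: "linked \<Omega> L a b \<Longrightarrow> a \<in> \<Omega> \<and> b \<in> \<Omega>"
  unfolding linked_def joins_in_def by (metis pathfinish_in_path_image pathstart_in_path_image subsetD)

lemma dist_start_le_curve_length:
  assumes "joins_in \<Omega> a b g" "t \<in> {0..1}" "curve_length g 0 t \<le> ennreal L" "0 \<le> L"
  shows "dist a (g t) \<le> L"
  using dist_le_curve_length[of 0 t g] assms
  by (auto simp: joins_in_def pathstart_def) (metis ennreal_le_iff order_trans)

lemma dist_finish_le_curve_length:
  assumes "joins_in \<Omega> a b g" "t \<in> {0..1}" "curve_length g t 1 \<le> ennreal L" "0 \<le> L"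
  shows "dist (g t) b \<le> L"
  using dist_le_curve_length[of t 1 g] assms
  by (auto simp: joins_in_def pathfinish_def) (metis ennreal_le_iff order_trans)

lemma path_image_subset_cball:
  assumes "joins_in \<Omega> a b g" "curve_length g 0 1 \<le> ennreal L" "0 \<le> L"
  shows "path_image g \<subseteq> cball a L"
proof
  fix p assume "p \<in> path_image g"
  then obtain t where t: "t \<in> {0..1}" "p = g t"
    by (auto simp: path_image_def)
  have "curve_length g 0 t \<le> ennreal L"
    using curve_length_mono[of 0 0 t 1 g] t assms(2) by auto
  then show "p \<in> cball a L"
    using dist_start_le_curve_length[OF assms(1) t(1) _ assms(3)] t(2) by auto
qed

lemma linked_dist_le: "linked \<Omega> L a b \<Longrightarrow> 0 \<le> L \<Longrightarrow> dist a b \<le> L"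
  unfolding linked_def joins_in_def
  using path_image_subset_cball[unfolded joins_in_def]
  by (metis mem_cball pathfinish_in_path_image subsetD)

lemma linked_initial:
  assumes "joins_in \<Omega> a b g" "t \<in> {0..1}" "curve_length g 0 t \<le> ennreal L"
  shows "linked \<Omega> L a (g t)"
proof -
  have "curve_length (subpath 0 t g) 0 1 \<le> curve_length g 0 t"
    using curve_length_comp_mono[of 0 1 "\<lambda>x. t * x" g] assms(2)
    by (auto simp: subpath_def o_def mono_on_def mult_left_mono)
  moreover have "joins_in \<Omega> a (g t) (subpath 0 t g)"
    unfolding joins_in_def
  proof (intro conjI)
    show "path (subpath 0 t g)" "path_image (subpath 0 t g) \<subseteq> \<Omega>"
      using assms path_image_subpath_subset[of 0 t g] by (auto simp: joins_in_def)
    show "pathstart (subpath 0 t g) = a" "pathfinish (subpath 0 t g) = g t"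
      using assms(1) by (simp_all add: joins_in_def pathstart_def[of g])
  qed
  ultimately show ?thesis
    using assms(3) unfolding linked_def by (meson order_trans)
qed

text \<open>Being linked at some finite cost is an equivalence relation with open classes.\<close>
lemma linked_in_domain:
  assumes "open \<Omega>" "connected \<Omega>" "a \<in> \<Omega>" "b \<in> \<Omega>"
  obtains L where "L > 0" "linked \<Omega> L a b"
proof -
  have "\<exists>L>0. linked \<Omega> L a b"
  proof (rule connected_equivalence_relation[OF assms(2-4)])
    show "\<exists>L>0. linked \<Omega> L y x" if "\<exists>L>0. linked \<Omega> L x y" for x y
      using that linked_sym by blast
    show "\<exists>L>0. linked \<Omega> L x z" if "\<exists>L>0. linked \<Omega> L x y" "\<exists>L>0. linked \<Omega> L y z" for x y z
    proof -
      from that obtain L M where "L > 0" "M > 0" "linked \<Omega> L x y" "linked \<Omega> M y z"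
        by blast
      then show ?thesis
        using linked_trans[of \<Omega> L x y M z] by (intro exI[of _ "L + M"]) auto
    qed
    fix x assume "x \<in> \<Omega>"
    then obtain r where r: "r > 0" "ball x r \<subseteq> \<Omega>"
      using assms(1) open_contains_ball by blast
    have "linked \<Omega> r x y" if "y \<in> ball x r" for y
      by (rule linked_segment)
         (use that r closed_segment_subset[of x "ball x r" y] in auto)
    then show "\<exists>T. openin (top_of_set \<Omega>) T \<and> x \<in> T \<and> (\<forall>y\<in>T. \<exists>L>0. linked \<Omega> L x y)"
      using r by (intro exI[of _ "ball x r"]) (auto simp: open_subset)
  qed
  then show thesis using that by blast
qed

section \<open>Inner uniformity in terms of distances to complementary points\<close>

text \<open>The distance of a point of \<open>\<Omega>\<close> to the boundary is its distance to the complement, so that the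
  condition on uniform curves can be tested on one complementary point \<open>e\<close> at a time.\<close>
lemma boundary_dist_le:
  assumes "z \<in> \<Omega>" "e \<notin> \<Omega>"
  shows "boundary_dist \<Omega> z \<le> ennreal (dist z e)"
proof -
  obtain w where w: "w \<in> closed_segment z e" "w \<in> frontier \<Omega>"
    using connected_Int_frontier[of "closed_segment z e" \<Omega>] assms by auto
  have "boundary_dist \<Omega> z \<le> ennreal (dist z w)"
    unfolding boundary_dist_def using w by (intro INF_lower) auto
  also have "dist z w \<le> dist z e"
    using dist_in_closed_segment[OF w(1)] by (simp add: dist_commute)
  finally show ?thesis
    by (meson ennreal_leI order_trans)
qed

lemma le_boundary_distI:
  assumes "open \<Omega>" "0 < C" "\<And>e. e \<notin> \<Omega> \<Longrightarrow> x \<le> ennreal (C * dist z e)"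
  shows "x \<le> ennreal C * boundary_dist \<Omega> z"
proof -
  have "x / ennreal C \<le> boundary_dist \<Omega> z"
    unfolding boundary_dist_def
  proof (rule INF_greatest)
    fix w assume "w \<in> frontier \<Omega>"
    then have "w \<notin> \<Omega>"
      using assms(1) by (simp add: frontier_def interior_open)
    from assms(3)[OF this] show "x / ennreal C \<le> ennreal (dist z w)"
      using assms(2) by (intro divide_le_posI_ennreal) (auto simp: ennreal_mult)
  qed
  then have "ennreal C * (x / ennreal C) \<le> ennreal C * boundary_dist \<Omega> z"
    by (rule mult_left_mono) simp
  then show ?thesis
    using assms(2) by (simp add: ennreal_times_divide mult_divide_eq_ennreal mult.commute)
qed

lemma inner_uniform_curve:
  assumes "inner_uniform A \<Omega>" "linked \<Omega> L a b" "0 \<le> L"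
  obtains \<gamma> where "joins_in \<Omega> a b \<gamma>" "curve_length \<gamma> 0 1 \<le> ennreal (A * L)"
    "\<And>t e. t \<in> {0..1} \<Longrightarrow> e \<notin> \<Omega> \<Longrightarrow>
        curve_length \<gamma> 0 t \<le> ennreal (A * dist (\<gamma> t) e) \<or> curve_length \<gamma> t 1 \<le> ennreal (A * dist (\<gamma> t) e)"
proof -
  have A: "A \<ge> 1" and ab: "a \<in> \<Omega>" "b \<in> \<Omega>"
    using assms linked_endpoints by (auto simp: inner_uniform_def)
  obtain \<gamma> where \<gamma>: "joins_in \<Omega> a b \<gamma>" "curve_length \<gamma> 0 1 \<le> ennreal A * inner_dist \<Omega> a b"
    "\<And>t. t \<in> {0..1} \<Longrightarrow> min (curve_length \<gamma> 0 t) (curve_length \<gamma> t 1) \<le> ennreal A * boundary_dist \<Omega> (\<gamma> t)"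
    using assms(1) ab unfolding inner_uniform_def by meson
  have "inner_dist \<Omega> a b \<le> ennreal L"
    using assms(2) unfolding linked_def inner_dist_def by (auto intro: INF_lower2)
  then have "curve_length \<gamma> 0 1 \<le> ennreal (A * L)"
    using \<gamma>(2) A assms(3) by (metis ennreal_mult mult_left_mono order_trans zero_le zero_le_one)
  moreover have "curve_length \<gamma> 0 t \<le> ennreal (A * dist (\<gamma> t) e) \<or> curve_length \<gamma> t 1 \<le> ennreal (A * dist (\<gamma> t) e)"
    if "t \<in> {0..1}" "e \<notin> \<Omega>" for t e
  proof -
    have "\<gamma> t \<in> \<Omega>"
      using \<gamma>(1) that(1) by (auto simp: joins_in_def path_image_def)
    then have "ennreal A * boundary_dist \<Omega> (\<gamma> t) \<le> ennreal A * ennreal (dist (\<gamma> t) e)"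
      using boundary_dist_le that(2) by (intro mult_left_mono) auto
    also have "\<dots> = ennreal (A * dist (\<gamma> t) e)"
      using A by (simp add: ennreal_mult)
    finally show ?thesis
      using \<gamma>(3)[OF that(1)] by (metis min_le_iff_disj order_trans)
  qed
  ultimately show thesis
    using that \<gamma>(1) by blast
qed

text \<open>The factor 2 pays for the infimum in the definition of the inner distance: between distinct
  points there are curves shorter than twice their inner distance.\<close>
lemma inner_uniformI:
  assumes C: "C \<ge> 1" and dom: "plane_domain \<Omega>"
    and curve: "\<And>a b L. a \<noteq> b \<Longrightarrow> linked \<Omega> L a b \<Longrightarrow> 0 < L \<Longrightarrow>
      \<exists>\<gamma>. joins_in \<Omega> a b \<gamma> \<and> curve_length \<gamma> 0 1 \<le> ennreal (C * L) \<and>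
        (\<forall>t\<in>{0..1}. \<forall>e. e \<notin> \<Omega> \<longrightarrow> curve_length \<gamma> 0 t \<le> ennreal (C * dist (\<gamma> t) e) \<or>
                                     curve_length \<gamma> t 1 \<le> ennreal (C * dist (\<gamma> t) e))"
  shows "inner_uniform (2 * C) \<Omega>"
  unfolding inner_uniform_def
proof (intro conjI ballI)
  show "1 \<le> 2 * C" "plane_domain \<Omega>"
    using C dom by auto
  fix a b assume ab: "a \<in> \<Omega>" "b \<in> \<Omega>"
  show "\<exists>\<gamma>. joins_in \<Omega> a b \<gamma> \<and> curve_length \<gamma> 0 1 \<le> ennreal (2 * C) * inner_dist \<Omega> a b \<and>
      (\<forall>t\<in>{0..1}. min (curve_length \<gamma> 0 t) (curve_length \<gamma> t 1) \<le> ennreal (2 * C) * boundary_dist \<Omega> (\<gamma> t))"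
  proof (cases "a = b")
    case True
    have "curve_length (linepath a a) 0 t \<le> 0" if "t \<in> {0..1}" for t
      using curve_length_linepath[of 0 t a a] that by simp
    then show ?thesis
      using True ab by (intro exI[of _ "linepath a a"]) (auto simp: joins_in_def)
  next
    case False
    have op: "open \<Omega>"
      using dom by (auto simp: plane_domain_def)
    obtain L0 where "L0 > 0" "linked \<Omega> L0 a b"
      using linked_in_domain[of \<Omega> a b] dom ab by (auto simp: plane_domain_def)
    then have "inner_dist \<Omega> a b \<le> ennreal L0"
      unfolding linked_def inner_dist_def by (auto intro: INF_lower2)
    then obtain r where r: "inner_dist \<Omega> a b = ennreal r" "0 \<le> r"
      by (metis ennreal_cases ennreal_less_top leD)
    have "ennreal (dist a b) \<le> inner_dist \<Omega> a b"
      unfolding inner_dist_def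
      using dist_le_curve_length[of 0 1] by (intro INF_greatest) (force simp: joins_in_def pathstart_def pathfinish_def)
    then have "r > 0"
      using False r by (metis dist_pos_lt ennreal_le_iff less_le_trans)
    then have "inner_dist \<Omega> a b < ennreal (2 * r)"
      using r by (simp add: ennreal_lessI)
    then have "linked \<Omega> (2 * r) a b"
      unfolding inner_dist_def linked_def INF_less_iff by (auto intro: less_imp_le)
    from curve[OF False this] \<open>r > 0\<close> obtain \<gamma> where
      \<gamma>: "joins_in \<Omega> a b \<gamma>" "curve_length \<gamma> 0 1 \<le> ennreal (C * (2 * r))"
      "\<And>t e. t \<in> {0..1} \<Longrightarrow> e \<notin> \<Omega> \<Longrightarrow> curve_length \<gamma> 0 t \<le> ennreal (C * dist (\<gamma> t) e) \<or>
                                     curve_length \<gamma> t 1 \<le> ennreal (C * dist (\<gamma> t) e)"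
      by auto
    have "curve_length \<gamma> 0 1 \<le> ennreal (2 * C) * inner_dist \<Omega> a b"
      using \<gamma>(2) r C by (simp add: ennreal_mult[symmetric] mult_ac)
    moreover have "min (curve_length \<gamma> 0 t) (curve_length \<gamma> t 1) \<le> ennreal (2 * C) * boundary_dist \<Omega> (\<gamma> t)"
      if "t \<in> {0..1}" for t
    proof (rule le_boundary_distI[OF op])
      fix e assume "e \<notin> \<Omega>"
      have "ennreal (C * dist (\<gamma> t) e) \<le> ennreal (2 * C * dist (\<gamma> t) e)"
        using C by (intro ennreal_leI) auto
      then show "min (curve_length \<gamma> 0 t) (curve_length \<gamma> t 1) \<le> ennreal (2 * C * dist (\<gamma> t) e)"
        using \<gamma>(3)[OF that \<open>e \<notin> \<Omega>\<close>] by (metis min_le_iff_disj order_trans)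
    qed (use C in auto)
    ultimately show ?thesis
      using \<gamma>(1) by blast
  qed
qed

section \<open>Roomy points\<close>

text \<open>Stop a uniform curve from \<open>x\<close> to a far away point at the last moment at which the length run
  through is at most \<open>s\<close>. Immediately afterwards this length exceeds \<open>s\<close>, and so does the remaining
  one, because the end of the curve is still at distance almost \<open>2 s\<close>; so the boundary is at
  distance at least \<open>s / A\<close>.\<close>
lemma roomy_point:
  assumes iu: "inner_uniform A \<Omega>" and x: "x \<in> \<Omega>" "q \<in> \<Omega>" and far: "3 * s \<le> dist x q" and "0 < s"
  obtains g where "linked \<Omega> s x g" "ball g (s / A) \<subseteq> \<Omega>"
proof -
  have A: "A \<ge> 1" and op: "open \<Omega>" "connected \<Omega>"
    using iu by (auto simp: inner_uniform_def plane_domain_def)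
  obtain L where L: "L > 0" "linked \<Omega> L x q"
    using linked_in_domain[OF op x] .
  obtain \<gamma> where \<gamma>: "joins_in \<Omega> x q \<gamma>"
    "\<And>t e. t \<in> {0..1} \<Longrightarrow> e \<notin> \<Omega> \<Longrightarrow>
        curve_length \<gamma> 0 t \<le> ennreal (A * dist (\<gamma> t) e) \<or> curve_length \<gamma> t 1 \<le> ennreal (A * dist (\<gamma> t) e)"
    using inner_uniform_curve[OF iu L(2)] L(1) by (metis less_imp_le)
  have cont: "continuous_on {0..1} \<gamma>" and ends: "\<gamma> 0 = x" "\<gamma> 1 = q"
    using \<gamma>(1) by (auto simp: joins_in_def path_def pathstart_def pathfinish_def)
  define T where "T = {t\<in>{0..1}. curve_length \<gamma> 0 t \<le> ennreal s}"
  define m where "m = Sup T"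
  have "curve_length \<gamma> 0 0 \<le> 0"
  proof (rule curve_length_leI)
    fix n t assume t: "t 0 = (0::real)" "t n = 0" "mono_on {..n::nat} t"
    have "t i = 0" if "i \<le> n" for i
      using that t mono_onD[OF t(3), of 0 i] mono_onD[OF t(3), of i n] by auto
    then show "(\<Sum>i<n. ennreal (dist (\<gamma> (t i)) (\<gamma> (t (Suc i))))) \<le> 0"
      by (intro order.eq_iff[THEN iffD1, THEN conjunct1] sum.neutral) auto
  qed
  then have "0 \<in> T"
    by (auto simp: T_def)
  have bdd: "bdd_above T"
    by (auto simp: T_def)
  have m: "0 \<le> m" "m \<le> 1"
    unfolding m_def using \<open>0 \<in> T\<close> bdd by (auto simp: T_def intro: cSup_upper cSup_least)
  have len_m: "curve_length \<gamma> 0 m \<le> ennreal s"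
  proof (cases "m = 0")
    case True
    then show ?thesis using \<open>curve_length \<gamma> 0 0 \<le> 0\<close> by auto
  next
    case False
    show ?thesis
    proof (rule curve_length_le_left_limit)
      show "continuous_on {0..m} \<gamma>"
        using cont m continuous_on_subset by fastforce
      fix \<tau> assume \<tau>: "0 \<le> \<tau>" "\<tau> < m"
      then obtain t where "t \<in> T" "\<tau> < t"
        using \<open>0 \<in> T\<close> less_cSup_iff[OF _ bdd] unfolding m_def by blast
      then show "curve_length \<gamma> 0 \<tau> \<le> ennreal s"
        using curve_length_mono[of 0 0 \<tau> t \<gamma>] \<tau> by (auto simp: T_def)
    qed (use m False \<open>0 < s\<close> in auto)
  qed
  have dm: "dist x (\<gamma> m) \<le> s"
    using dist_start_le_curve_length[OF \<gamma>(1) _ len_m] m \<open>0 < s\<close> by auto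
  then have "m < 1"
    using m far \<open>0 < s\<close> ends by (cases "m = 1") auto
  have "e \<in> \<Omega>" if e: "dist (\<gamma> m) e < s / A" for e
  proof (rule ccontr)
    assume "e \<notin> \<Omega>"
    have "(\<gamma> \<longlongrightarrow> \<gamma> m) (at_right m)"
      using continuous_on_subset[OF cont, of "{m..1}"] m \<open>m < 1\<close>
      by (auto intro: continuous_on_Icc_at_rightD)
    then have "((\<lambda>t. dist (\<gamma> t) e) \<longlongrightarrow> dist (\<gamma> m) e) (at_right m)"
      "((\<lambda>t. dist (\<gamma> t) (\<gamma> m)) \<longlongrightarrow> dist (\<gamma> m) (\<gamma> m)) (at_right m)"
      by (rule tendsto_dist[OF _ tendsto_const])+
    then have "eventually (\<lambda>t. dist (\<gamma> t) e < s / A \<and> dist (\<gamma> t) (\<gamma> m) < s \<and> t < 1) (at_right m)"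
      using e \<open>0 < s\<close> \<open>m < 1\<close>
      by (intro eventually_conj order_tendstoD eventually_at_right_less) 
         (auto simp: eventually_at_right_field)
    then obtain t where t: "m < t" "t < 1" "dist (\<gamma> t) e < s / A" "dist (\<gamma> t) (\<gamma> m) < s"
      unfolding eventually_at_right_field using dense \<open>m < 1\<close> by (metis dense)
    have t01: "t \<in> {0..1}" using t m by auto
    have "A * dist (\<gamma> t) e < s"
      using t(3) A by (simp add: field_simps)
    have "t \<notin> T"
      using t(1) cSup_upper[OF _ bdd] unfolding m_def by force
    then have "\<not> curve_length \<gamma> 0 t \<le> ennreal s"
      using t01 by (auto simp: T_def)
    moreover have "dist (\<gamma> t) q > A * dist (\<gamma> t) e"
      using \<open>A * dist (\<gamma> t) e < s\<close> t(4) dm far dist_triangle[of x q "\<gamma> t"] dist_triangle[of x "\<gamma> t" "\<gamma> m"]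
      by (simp add: dist_commute)
    then have "\<not> curve_length \<gamma> t 1 \<le> ennreal (A * dist (\<gamma> t) e)"
      using dist_finish_le_curve_length[OF \<gamma>(1) t01] A by fastforce
    ultimately show False
      using \<gamma>(2)[OF t01 \<open>e \<notin> \<Omega>\<close>] \<open>A * dist (\<gamma> t) e < s\<close> by (meson ennreal_leI less_imp_le order_trans)
  qed
  then have "ball (\<gamma> m) (s / A) \<subseteq> \<Omega>"
    by auto
  then show thesis
    using that linked_initial[OF \<gamma>(1) _ len_m] m by auto
qed

section \<open>Short chains\<close>

text \<open>Cut out the part of the chain between its first point and its last visit to the piece
  containing that point; the rest avoids this piece.\<close>
lemma shorten_chain:
  assumes "finite I" and clique: "\<And>i x y. i \<in> I \<Longrightarrow> x \<in> P i \<Longrightarrow> y \<in> P i \<Longrightarrow> R x y"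
    and "\<And>i. i < k \<Longrightarrow> R (h i) (h (Suc i))" "\<And>i. i \<le> k \<Longrightarrow> h i \<in> \<Union>(P ` I)"
  shows "\<exists>n \<le> 2 * card I. (R ^^ n) (h 0) (h (k::nat))"
  using assms
proof (induction "card I" arbitrary: I h k)
  case 0
  then show ?case by force
next
  case (Suc m)
  from Suc.prems(4)[of 0] obtain p where p: "p \<in> I" "h 0 \<in> P p" by auto
  define j where "j = Max {i. i \<le> k \<and> h i \<in> P p}"
  have fin: "finite {i. i \<le> k \<and> h i \<in> P p}" by simp
  have "j \<in> {i. i \<le> k \<and> h i \<in> P p}"
    unfolding j_def using p by (intro Max_in) auto
  then have j: "j \<le> k" "h j \<in> P p" by auto
  have last: "h i \<notin> P p" if "j < i" "i \<le> k" for i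
    using that Max_ge[OF fin, of i] unfolding j_def by (metis (mono_tags, lifting) leD mem_Collect_eq)
  have R0: "R (h 0) (h j)"
    using Suc.prems(2) p j by blast
  show ?case
  proof (cases "j = k")
    case True
    have "(R ^^ 1) (h 0) (h k)"
      using R0 True by (simp only: relpowp_1)
    then show ?thesis
      using Suc.hyps(2) by (intro exI[of _ 1]) auto
  next
    case False
    let ?h = "\<lambda>i. h (Suc j + i)" and ?k = "k - Suc j"
    have "\<exists>n \<le> 2 * card (I - {p}). (R ^^ n) (?h 0) (?h ?k)"
    proof (rule Suc.hyps(1))
      show "m = card (I - {p})"
        using Suc.hyps(2) p(1) Suc.prems(1) by simp
      show "?h i \<in> \<Union>(P ` (I - {p}))" if "i \<le> ?k" for i
      proof -
        have "Suc j + i \<le> k" using that False j by linarith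
        then show ?thesis
          using Suc.prems(4)[of "Suc j + i"] last[of "Suc j + i"] by auto
      qed
      show "R (?h i) (?h (Suc i))" if "i < ?k" for i
        using Suc.prems(3)[of "Suc j + i"] that False j by auto
    qed (use Suc.prems in auto)
    then obtain n where n: "n \<le> 2 * card (I - {p})" "(R ^^ n) (h (Suc j)) (h k)"
      using False j by auto
    have "R (h j) (h (Suc j))"
      using Suc.prems(3) False j by simp
    with R0 n(2) have "(R ^^ Suc (Suc n)) (h 0) (h k)"
      by (meson relpowp_Suc_I2)
    moreover have "Suc (Suc n) \<le> 2 * card I"
      using n(1) Suc.hyps(2) p(1) Suc.prems(1) by simp
    ultimately show ?thesis by blast
  qed
qed

text \<open>By connectedness, \<open>x\<close> and \<open>y\<close> are joined by a chain in \<open>X\<close> with linked images of successive points.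
  Cover the region containing the images by discs of radius \<open>\<delta> / 2\<close>; images in one disc are linked
  directly, so twice the number of discs bounds the number of links needed. This number depends
  on \<open>M\<close> only.\<close>
lemma linked_along_connected_set:
  fixes M :: real
  obtains N :: nat where
    "\<And>X f U c \<delta> K x y. \<lbrakk>connected X; 0 < \<delta>; 0 \<le> K; \<And>x. x \<in> X \<Longrightarrow> dist c (f x) \<le> M * \<delta>;
      \<And>x. x \<in> X \<Longrightarrow> \<exists>T. open T \<and> x \<in> T \<and> (\<forall>y\<in>X \<inter> T. linked U K (f x) (f y));
      \<And>x y. x \<in> X \<Longrightarrow> y \<in> X \<Longrightarrow> dist (f x) (f y) < \<delta> \<Longrightarrow> linked U K (f x) (f y);
      x \<in> X; y \<in> X\<rbrakk> \<Longrightarrow> linked U (real N * K) (f (x::complex)) (f y)"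
proof -
  have cov: "cball (0::complex) M \<subseteq> (\<Union>p\<in>UNIV. ball p (1/2))"
  proof
    fix x :: complex
    have "x \<in> ball x (1/2)" by simp
    then show "x \<in> (\<Union>p\<in>UNIV. ball p (1/2))" by (rule UN_I[OF UNIV_I])
  qed
  obtain F where F: "finite F" "cball (0::complex) M \<subseteq> (\<Union>p\<in>F. ball p (1/2))"
    by (rule compactE_image[OF compact_cball _ cov]) auto
  have key: "linked U (real (2 * card F) * K) (f x) (f y)"
    if conn: "connected X" and \<delta>: "0 < \<delta>" and K: "0 \<le> K" and bd: "\<And>x. x \<in> X \<Longrightarrow> dist c (f x) \<le> M * \<delta>"
      and loc: "\<And>x. x \<in> X \<Longrightarrow> \<exists>T. open T \<and> x \<in> T \<and> (\<forall>y\<in>X \<inter> T. linked U K (f x) (f y))"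
      and close: "\<And>x y. x \<in> X \<Longrightarrow> y \<in> X \<Longrightarrow> dist (f x) (f y) < \<delta> \<Longrightarrow> linked U K (f x) (f y)"
      and xy: "x \<in> X" "y \<in> X" for X f U c \<delta> K x and y :: complex
  proof -
    define R where "R u v \<longleftrightarrow> u \<in> X \<and> v \<in> X \<and> linked U K (f u) (f v)" for u v
    define P where "P p = {u\<in>X. (f u - c) /\<^sub>R \<delta> \<in> ball p (1/2)}" for p
    have clique: "R u v" if "u \<in> P p" "v \<in> P p" for p u v
    proof -
      let ?u = "(f u - c) /\<^sub>R \<delta>" and ?v = "(f v - c) /\<^sub>R \<delta>"
      have "dist ?u ?v < 1"
        using that dist_triangle2[of ?u ?v p] by (auto simp: P_def dist_commute)
      also have "dist ?u ?v = dist (f u) (f v) / \<delta>"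
        using \<delta> by (simp add: dist_norm scaleR_diff_right[symmetric] divide_inverse mult.commute)
      finally have "dist (f u) (f v) < \<delta>"
        using \<delta> by simp
      then show ?thesis
        using that close by (auto simp: R_def P_def)
    qed
    have cover: "u \<in> \<Union>(P ` F)" if "u \<in> X" for u
    proof -
      have "norm ((f u - c) /\<^sub>R \<delta>) = dist c (f u) / \<delta>"
        using \<delta> by (simp add: dist_norm norm_minus_commute divide_inverse mult.commute)
      also have "\<dots> \<le> M"
        using bd[OF that] \<delta> by (simp add: field_simps)
      finally show ?thesis
        using F(2) that by (force simp: P_def)
    qed
    have "R\<^sup>*\<^sup>* x y"
    proof (rule connected_equivalence_relation[OF conn xy])
      have "symp R"
        by (auto simp: R_def symp_def linked_sym)
      then show "R\<^sup>*\<^sup>* v u" if "R\<^sup>*\<^sup>* u v" for u v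
        using that by (meson symp_rtranclp sympD)
      fix u assume u: "u \<in> X"
      obtain T where "open T" "u \<in> T" "\<forall>v\<in>X \<inter> T. linked U K (f u) (f v)"
        using loc[OF u] by blast
      then show "\<exists>T. openin (top_of_set X) T \<and> u \<in> T \<and> (\<forall>v\<in>T. R\<^sup>*\<^sup>* u v)"
        using u by (intro exI[of _ "X \<inter> T"]) (auto simp: R_def)
    qed auto
    then obtain k where "(R ^^ k) x y"
      by (auto simp: rtranclp_power)
    then obtain h where h: "h 0 = x" "h k = y" "\<forall>i<k. R (h i) (h (Suc i))"
      unfolding relpowp_fun_conv by blast
    have "h i \<in> X" if "i \<le> k" for i
      using h xy that by (cases "i = k") (auto simp: R_def)
    then obtain n where n: "n \<le> 2 * card F" "(R ^^ n) x y"
      using shorten_chain[OF F(1), of P R k h] clique cover h by auto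
    have "linked U (real n * K) (f x) (f v)" if "(R ^^ n) x v" for n v
      using that
    proof (induction n arbitrary: v)
      case 0
      then have "f x \<in> U"
        using close[OF xy(1) xy(1)] \<delta> linked_endpoints by auto
      then show ?case
        using 0 by (simp add: linked_refl)
    next
      case (Suc n)
      then obtain w where "linked U (real n * K) (f x) (f w)" "linked U K (f w) (f v)"
        by (auto simp: R_def)
      then show ?case
        using linked_trans[of U "real n * K" "f x" "f w" K] K by (simp add: algebra_simps)
    qed
    from this[OF n(2)] show ?thesis
      using n(1) K by (elim linked_mono) (auto intro!: mult_right_mono)
  qed
  show thesis
    by (rule that[of "2 * card F"]) (fact key)
qed

section \<open>Plane topology\<close>

text \<open>A component \<open>W\<close> of the larger open set that misses \<open>- E\<close> would lie in a component of \<open>E\<close>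
  disjoint from \<open>P\<close>, so its closure would still avoid \<open>P\<close>, and \<open>W\<close> would be closed.\<close>
lemma connected_complement_of_components:
  fixes E P :: "complex set"
  assumes "closed E" "connected (- E)" "- E \<noteq> {}" "P \<subseteq> E" "closed P"
    and comps: "\<And>S. S \<in> components E \<Longrightarrow> S \<inter> P \<noteq> {} \<Longrightarrow> S \<subseteq> P"
  shows "connected (- P)"
proof -
  have meets: "W \<inter> - E \<noteq> {}" if W: "W \<in> components (- P)" for W
  proof
    assume "W \<inter> - E = {}"
    then have "W \<subseteq> E" by auto
    have Wp: "connected W" "W \<noteq> {}" "W \<subseteq> - P" "open W"
      using W \<open>closed P\<close> by (auto dest: in_components_connected in_components_nonempty in_components_subset
          intro: open_components)
    obtain S where S: "S \<in> components E" "W \<subseteq> S"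
      using exists_component_superset[OF \<open>W \<subseteq> E\<close>] Wp \<open>W \<subseteq> E\<close> by blast
    have "S \<inter> P = {}"
      using comps[OF S(1)] S(2) Wp by blast
    have "closure W \<subseteq> S"
      using S closed_components[OF \<open>closed E\<close>] by (intro closure_minimal) auto
    then have "closure W \<subseteq> - P"
      using \<open>S \<inter> P = {}\<close> by auto
    then have "closure W \<subseteq> W"
      using Wp closure_subset[of W] by (intro components_maximal[OF W] connected_imp_connected_closure) auto
    then have "closed W"
      using closure_subset_eq by blast
    then have "W = UNIV"
      using Wp clopen by blast
    then show False
      using \<open>W \<inter> - E = {}\<close> \<open>- E \<noteq> {}\<close> by auto
  qed
  obtain e0 where e0: "e0 \<in> - E"
    using \<open>- E \<noteq> {}\<close> by blast
  have to_e0: "connected_component (- P) x e0" if x: "x \<in> - P" for x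
  proof -
    have "connected_component_set (- P) x \<in> components (- P)"
      using x by (rule componentsI)
    from meets[OF this] obtain e where e: "connected_component (- P) x e" "e \<in> - E"
      by auto
    have "connected_component (- P) e e0"
      unfolding connected_component_def using e(2) e0 assms by (intro exI[of _ "- E"]) auto
    then show ?thesis
      using e(1) connected_component_trans by blast
  qed
  show ?thesis
    unfolding connected_iff_connected_component
    by (meson to_e0 connected_component_sym connected_component_trans)
qed

text \<open>Components of a compact set have arbitrarily small relatively clopen neighbourhoods, so the
  connected set \<open>X\<close> has an open connected neighbourhood \<open>Y\<close> in \<open>B\<close> whose intersection with \<open>E\<close> is
  relatively clopen. This intersection has connected complement, and removing from \<open>Y\<close> a compact
  set that does not separate the plane does not disconnect \<open>Y\<close>, by Janiszewski's theorem.\<close>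
lemma connected_neighbourhood_minus_compact:
  fixes E X B :: "complex set"
  assumes E: "compact E" "connected (- E)" and X: "compact X" "connected X" "X \<noteq> {}"
    and B: "open B" "X \<subseteq> B" and comps: "\<And>S. S \<in> components E \<Longrightarrow> S \<inter> X \<noteq> {} \<Longrightarrow> S \<subseteq> B"
  obtains Y where "open Y" "X \<subseteq> Y" "Y \<subseteq> B" "connected (Y - E)"
    "\<And>S. S \<in> components E \<Longrightarrow> S \<inter> Y \<noteq> {} \<Longrightarrow> S \<subseteq> Y"
proof -
  have "\<exists>V. open V \<and> x \<in> V \<and> V \<subseteq> B \<and> compact (E \<inter> V)" if x: "x \<in> X" for x
  proof (cases "x \<in> E")
    case False
    have "E \<inter> (B - E) = {}" by auto
    then show ?thesis
      using False x B E compact_imp_closed by (intro exI[of _ "B - E"]) auto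
  next
    case True
    define S where "S = connected_component_set E x"
    have S: "S \<in> components E" "x \<in> S"
      unfolding S_def using True by (auto intro: componentsI)
    have "S \<subseteq> B"
      using comps[OF S(1)] S(2) x by blast
    moreover have "compact S"
      using S(1) E(1) compact_components by blast
    moreover have "locally compact E"
      using E(1) by (simp add: closed_imp_locally_compact compact_imp_closed)
    ultimately obtain K where K: "openin (top_of_set E) K" "compact K" "S \<subseteq> K" "K \<subseteq> B"
      using Sura_Bura_clopen_subset S(1) B(1) by metis
    then obtain T where T: "open T" "K = E \<inter> T"
      by (auto simp: openin_open)
    then have "E \<inter> (T \<inter> B) = K"
      using K(4) by auto
    then show ?thesis
      using T K S x B by (intro exI[of _ "T \<inter> B"]) auto
  qed
  then obtain V where V: "\<And>x. x \<in> X \<Longrightarrow> open (V x)" "\<And>x. x \<in> X \<Longrightarrow> x \<in> V x"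
    "\<And>x. x \<in> X \<Longrightarrow> V x \<subseteq> B" "\<And>x. x \<in> X \<Longrightarrow> compact (E \<inter> V x)"
    by metis
  have cov: "X \<subseteq> (\<Union>x\<in>X. V x)"
    using V(2) by blast
  obtain X0 where X0: "X0 \<subseteq> X" "finite X0" "X \<subseteq> (\<Union>x\<in>X0. V x)"
    by (rule compactE_image[OF X(1) V(1) cov]) auto
  define Y1 where "Y1 = (\<Union>x\<in>X0. V x)"
  have Y1: "open Y1" "X \<subseteq> Y1" "Y1 \<subseteq> B"
    unfolding Y1_def using X0 V by blast+
  have "E \<inter> Y1 = (\<Union>x\<in>X0. E \<inter> V x)"
    by (auto simp: Y1_def)
  then have EY1: "compact (E \<inter> Y1)"
    using X0 V(4) by (metis (no_types, lifting) compact_UN subsetD)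
  obtain x0 where x0: "x0 \<in> X"
    using X(3) by blast
  define Y where "Y = connected_component_set Y1 x0"
  have Yc: "Y \<in> components Y1"
    unfolding Y_def using x0 Y1 by (auto intro: componentsI)
  have Y: "open Y" "connected Y" "Y \<subseteq> Y1" "X \<subseteq> Y"
  proof -
    show "open Y" "connected Y" "Y \<subseteq> Y1"
      using Yc Y1(1) by (auto intro: open_components in_components_connected dest: in_components_subset)
    show "X \<subseteq> Y"
      unfolding Y_def using X Y1(2) x0 by (intro connected_component_maximal) auto
  qed
  have "open (\<Union>(components Y1 - {Y}))"
    using Y1(1) by (auto intro: open_components)
  moreover have "E \<inter> Y = (E \<inter> Y1) \<inter> - \<Union>(components Y1 - {Y})"
    using in_components_unions_complement[OF Yc] Y(3) by blast
  ultimately have EY: "compact (E \<inter> Y)"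
    using EY1 by (metis closed_Compl compact_Int_closed)
  have sub: "S \<subseteq> Y" if S: "S \<in> components E" "S \<inter> Y \<noteq> {}" for S
  proof -
    have "S \<subseteq> E" "connected S"
      using S(1) in_components_subset in_components_connected by blast+
    have "openin (top_of_set S) (S \<inter> Y)"
      using Y(1) by blast
    moreover have "S \<inter> Y = S \<inter> (E \<inter> Y)"
      using \<open>S \<subseteq> E\<close> by auto
    then have "closedin (top_of_set S) (S \<inter> Y)"
      using compact_imp_closed[OF EY] by (metis closedin_closed_Int)
    ultimately have "S \<inter> Y = S"
      using \<open>connected S\<close> S(2) unfolding connected_clopen by blast
    then show ?thesis by blast
  qed
  have "- E \<noteq> {}"
    using E(1) by (metis Compl_empty_eq Compl_eq_Compl_iff double_complement not_compact_UNIV)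
  have co: "connected (- (E \<inter> Y))"
  proof (rule connected_complement_of_components[of E])
    show "S \<subseteq> E \<inter> Y" if "S \<in> components E" "S \<inter> (E \<inter> Y) \<noteq> {}" for S
      using sub[of S] that in_components_subset by blast
  qed (use E EY \<open>- E \<noteq> {}\<close> in \<open>auto intro: compact_imp_closed\<close>)
  have "connected (Y - E)"
    unfolding connected_iff_connected_component
  proof (intro ballI)
    fix a b assume ab: "a \<in> Y - E" "b \<in> Y - E"
    have "connected_component (- ((E \<inter> Y) \<union> - Y)) a b"
    proof (rule Janiszewski[OF EY])
      show "connected_component (- (E \<inter> Y)) a b"
        unfolding connected_component_def using co ab by (intro exI[of _ "- (E \<inter> Y)"]) auto
      show "connected_component (- (- Y)) a b"
        unfolding connected_component_def using Y(2) ab by (intro exI[of _ Y]) auto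
    qed (use Y(1) in auto)
    moreover have "- ((E \<inter> Y) \<union> - Y) = Y - E" by auto
    ultimately show "connected_component (Y - E) a b" by simp
  qed
  then show thesis
    using that[of Y] Y Y1 sub by blast
qed

text \<open>A logarithm would factor the identity of the circle through the contractible plane.\<close>
lemma no_logarithm_on_circle:
  assumes "0 < r" and cont: "continuous_on (sphere a r) g"
    and exp: "\<And>z. z \<in> sphere a r \<Longrightarrow> exp (g z) = z - (a::complex)"
  shows False
proof -
  define \<phi> where "\<phi> w = a + of_real r * exp (\<i> * of_real (Im w))" for w
  have "continuous_on UNIV \<phi>"
    unfolding \<phi>_def by (intro continuous_intros)
  moreover have "\<phi> \<in> UNIV \<rightarrow> sphere a r"
    using \<open>0 < r\<close> by (auto simp: \<phi>_def dist_norm norm_mult)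
  moreover have "contractible (UNIV :: complex set)"
    by (simp add: convex_imp_contractible)
  ultimately obtain c where c: "homotopic_with_canon (\<lambda>h. True) (sphere a r) (sphere a r) (\<phi> \<circ> g) (\<lambda>x. c)"
    using nullhomotopic_through_contractible[of "sphere a r" g UNIV \<phi> "sphere a r"] cont by blast
  have id: "(\<phi> \<circ> g) z = z" if z: "z \<in> sphere a r" for z
  proof -
    have "r = exp (Re (g z))"
      using exp[OF z] z by (metis dist_norm mem_sphere norm_exp_eq_Re norm_minus_commute)
    then have "of_real r * exp (\<i> * of_real (Im (g z))) = exp (g z)"
      by (simp add: exp_eq_polar[of "g z"] cis_conv_exp)
    then show ?thesis
      using exp[OF z] by (simp add: \<phi>_def)
  qed
  have "homotopic_with_canon (\<lambda>h. True) (sphere a r) (sphere a r) id (\<lambda>x. c)"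
    by (rule homotopic_with_eq[OF c]) (use id in auto)
  then have "contractible (sphere a r)"
    unfolding contractible_def by blast
  then show False
    using \<open>0 < r\<close> by (simp add: contractible_sphere)
qed

text \<open>If \<open>z1\<close> and \<open>z2\<close> are separated in \<open>F\<close> by disjoint compact sets \<open>P\<close> and \<open>Q\<close>, the given logarithm
  can be cut off to interpolate between the function \<open>1 / (z - z2)\<close> near \<open>P\<close> and the function
  \<open>1 / (z - z1)\<close> near \<open>Q\<close>. The result is a zero-free function on the plane; its
  logarithm yields a logarithm of \<open>z - z1\<close> on large circles.\<close>
lemma connected_component_of_logarithm:
  fixes F :: "complex set"
  assumes F: "compact F" "z1 \<in> F" "z2 \<in> F"
    and cont: "continuous_on (- F) L"
    and L: "\<And>z. z \<notin> F \<Longrightarrow> exp (L z) = (z - z1) / (z - z2)"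
  shows "connected_component F z1 z2"
proof (rule ccontr)
  assume neg: "\<not> connected_component F z1 z2"
  define S where "S = connected_component_set F z1"
  have S: "S \<in> components F" "z1 \<in> S" "S \<subseteq> - {z2}"
    unfolding S_def using F neg by (auto intro: componentsI)
  have "compact S" "locally compact F"
    using S(1) F(1) compact_components by (auto simp: closed_imp_locally_compact compact_imp_closed)
  then obtain P where P: "openin (top_of_set F) P" "compact P" "S \<subseteq> P" "P \<subseteq> - {z2}"
    using Sura_Bura_clopen_subset S by (metis open_Compl closed_singleton)
  then obtain T where T: "open T" "P = F \<inter> T"
    by (auto simp: openin_open)
  define Q where "Q = F - T"
  have Q: "closed Q" "P \<inter> Q = {}" "F = P \<union> Q" "z2 \<in> Q"
    unfolding Q_def using T F P(4) by (auto intro: compact_imp_closed closed_Diff)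
  obtain f :: "complex \<Rightarrow> real" where f: "continuous_on UNIV f" "\<And>x. x \<in> P \<Longrightarrow> f x = 1" "\<And>x. x \<in> Q \<Longrightarrow> f x = 0"
    by (rule Urysohn[OF compact_imp_closed[OF P(2)] Q(1,2), where a = 1 and b = "0::real"]) blast
  define \<eta> where "\<eta> z = min 1 (max 0 (3 * f z - 1))" for z
  define U1 where "U1 = {z. f z > 2/3}"
  define U0 where "U0 = {z. f z < 1/3}"
  have op: "open U1" "open U0" "open (- F)"
    unfolding U1_def U0_def using f(1) F(1) compact_imp_closed
    by (auto intro!: open_Collect_less continuous_intros)
  have z1: "z1 \<in> P" using S P by auto
  have notin: "z2 \<notin> U1" "z1 \<notin> U0"
    using f(2)[OF z1] f(3)[OF Q(4)] by (auto simp: U1_def U0_def)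
  have disj: "U1 \<inter> U0 = {}"
    by (auto simp: U1_def U0_def)
  have PU: "P \<subseteq> U1" "Q \<subseteq> U0"
    using f by (auto simp: U1_def U0_def)
  define G where "G z = exp (of_real (\<eta> z) * L z) / (z - z1)" for z
  define H where "H z = (if z \<in> U1 then 1 / (z - z2) else if z \<in> U0 then 1 / (z - z1) else G z)" for z
  have H1: "H z = 1 / (z - z2)" if "z \<in> U1" for z
    using that by (simp add: H_def)
  have H0: "H z = 1 / (z - z1)" if "z \<in> U0" for z
    using that disj by (auto simp: H_def)
  have HG: "H z = G z" if "z \<in> - F" for z
  proof -
    have "z \<noteq> z1" "z \<noteq> z2" using that F by auto
    have "\<eta> z = 1" if "z \<in> U1" using that by (auto simp: \<eta>_def U1_def)
    moreover have "\<eta> z = 0" if "z \<in> U0" using that by (auto simp: \<eta>_def U0_def)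
    ultimately show ?thesis
      using L[of z] that \<open>z \<noteq> z1\<close> \<open>z \<noteq> z2\<close> by (auto simp: H_def G_def)
  qed
  have contG: "continuous_on (- F) G"
    unfolding G_def \<eta>_def using F(2) by (auto intro!: continuous_intros cont continuous_on_subset[OF f(1)])
  have "continuous_on (- F) H"
    using contG HG by (metis continuous_on_cong)
  moreover have "continuous_on U1 H"
  proof -
    have "continuous_on U1 (\<lambda>z. 1 / (z - z2))"
      using notin by (auto intro!: continuous_intros)
    then show ?thesis using H1 by (metis (no_types, lifting) continuous_on_cong)
  qed
  moreover have "continuous_on U0 H"
  proof -
    have "continuous_on U0 (\<lambda>z. 1 / (z - z1))"
      using notin by (auto intro!: continuous_intros)
    then show ?thesis using H0 by (metis (no_types, lifting) continuous_on_cong)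
  qed
  moreover have un: "- F \<union> (U1 \<union> U0) = UNIV"
    using PU Q(3) by auto
  ultimately have "continuous_on UNIV H"
    using continuous_on_open_Un[OF op(3) open_Un[OF op(1,2)], of H] continuous_on_open_Un[OF op(1,2), of H]
    by metis
  moreover have "H z \<noteq> 0" for z
  proof -
    consider "z \<in> - F" | "z \<in> U1" | "z \<in> U0" using un by blast
    then show ?thesis
      using H1[of z] H0[of z] HG[of z] notin F(2) by cases (auto simp: G_def)
  qed
  moreover have "contractible (UNIV :: complex set)"
    by (simp add: convex_imp_contractible)
  ultimately obtain h where h: "continuous_on UNIV h" "\<And>z. H z = exp (h z)"
    using continuous_logarithm_on_contractible[of UNIV H] by auto
  have "bounded F"
    using F(1) compact_imp_bounded by blast
  then obtain r where r: "r > 0" "F \<subseteq> ball z1 r"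
    using bounded_subset_ballD by blast
  have sph: "sphere z1 r \<subseteq> - F"
    using r(2) by auto
  show False
  proof (rule no_logarithm_on_circle[OF r(1)])
    show "continuous_on (sphere z1 r) (\<lambda>z. of_real (\<eta> z) * L z - h z)"
      unfolding \<eta>_def
      by (intro continuous_intros continuous_on_subset[OF f(1)] continuous_on_subset[OF cont sph]
          continuous_on_subset[OF h(1)]) auto
    fix z assume z: "z \<in> sphere z1 r"
    then have "exp (h z) = exp (of_real (\<eta> z) * L z) / (z - z1)"
      using HG[of z] sph h(2)[of z] by (auto simp: G_def)
    moreover have "z - z1 \<noteq> 0" using z r(1) by auto
    ultimately show "exp (of_real (\<eta> z) * L z - h z) = z - z1"
      by (simp add: exp_diff)
  qed
qed

text \<open>Adding to \<open>S\<close> the exterior of the disc leaves a connected set, so the components of the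
  complement are simply connected.\<close>
lemma logarithm_on_ball_minus_connected:
  fixes S :: "complex set"
  assumes S: "closed S" "connected S" "z0 \<in> S" "\<not> S \<subseteq> ball c R"
  obtains g where "continuous_on (ball c R - S) g" "\<And>w. w \<in> ball c R - S \<Longrightarrow> exp (g w) = w - z0"
proof -
  define M where "M = S \<union> - ball c R"
  define D where "D = ball c R - S"
  have D: "D = - M" "open D" "bounded D"
    using S(1) by (auto simp: M_def D_def intro: bounded_subset[OF bounded_ball[of c R]])
  have "connected (- ball c R)"
    by (intro connected_complement_bounded_convex) auto
  then have "connected M"
    unfolding M_def using S by (intro connected_Un) auto
  have "\<exists>g. continuous_on W g \<and> (\<forall>w\<in>W. exp (g w) = w - z0)" if W: "W \<in> components D" for W
  proof -
    have W': "open W" "bounded W" "connected W" "W \<subseteq> D"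
      using W D by (auto intro: open_components bounded_subset dest: in_components_subset in_components_connected)
    have "connected (- W)"
      using component_complement_connected[OF \<open>connected M\<close>] W D(1) by auto
    then have "simply_connected W"
      using simply_connected_iff_simple[OF W'(1,2)] W'(3) by blast
    moreover have "locally path_connected W"
      using W'(1) open_imp_locally_path_connected by blast
    moreover have "w - z0 \<noteq> 0" if "w \<in> W" for w
      using that W'(4) S(3) by (auto simp: D_def)
    moreover have "continuous_on W (\<lambda>w. w - z0)"
      by (intro continuous_intros)
    ultimately show ?thesis
      using continuous_logarithm_on_simply_connected[of W "\<lambda>w. w - z0"] by metis
  qed
  then obtain g where g: "\<And>W. W \<in> components D \<Longrightarrow> continuous_on W (g W)"
    "\<And>W w. W \<in> components D \<Longrightarrow> w \<in> W \<Longrightarrow> exp (g W w) = w - z0"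
    by metis
  define h where "h w = g (connected_component_set D w) w" for w
  have hW: "h w = g W w" if "W \<in> components D" "w \<in> W" for W w
    using that unfolding h_def by (metis components_iff connected_component_eq)
  have "continuous_on W h" if "W \<in> components D" for W
    using g(1)[OF that] hW[OF that] by (metis (no_types, lifting) continuous_on_cong)
  then have "continuous_on D h"
    using continuous_on_components_open[OF D(2)] by blast
  moreover have "exp (h w) = w - z0" if "w \<in> D" for w
    unfolding h_def using g(2)[of "connected_component_set D w" w] that by (auto intro: componentsI)
  ultimately show thesis
    using that unfolding D_def by blast
qed

text \<open>The principal logarithm works, because the quotient is a nonpositive real exactly on the segment.\<close>
lemma logarithm_off_segment:
  fixes z1 z2 :: complex
  obtains g where "continuous_on (- closed_segment z1 z2) g"
    "\<And>z. z \<notin> closed_segment z1 z2 \<Longrightarrow> exp (g z) = (z - z1) / (z - z2)"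
proof -
  let ?q = "\<lambda>z. (z - z1) / (z - z2)"
  have q: "?q z \<notin> \<real>\<^sub>\<le>\<^sub>0" if z: "z \<notin> closed_segment z1 z2" for z
  proof
    assume "?q z \<in> \<real>\<^sub>\<le>\<^sub>0"
    then obtain c where c: "c \<ge> 0" "?q z = - of_real c"
      by (metis nonpos_Reals_cases of_real_minus minus_minus neg_0_le_iff_le)
    have "z \<noteq> z2" using z by auto
    then have "z - z1 = - of_real c * (z - z2)"
      using c(2) by (simp add: field_simps)
    then have "(1 + of_real c) * z = z1 + of_real c * z2"
      by (simp add: algebra_simps)
    moreover have c1: "(1 + of_real c :: complex) = of_real (1 + c)" by simp
    ultimately have "of_real (1 + c) * z = z1 + of_real c * z2"
      by metis
    then have "z = (z1 + of_real c * z2) / of_real (1 + c)"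
      using c(1) by (simp add: field_simps del: of_real_add)
    then have "z = (1 - c / (1 + c)) *\<^sub>R z1 + (c / (1 + c)) *\<^sub>R z2"
      using c(1) by (simp add: scaleR_conv_of_real divide_simps)
    moreover have "0 \<le> c / (1 + c)" "c / (1 + c) \<le> 1"
      using c(1) by (auto simp: divide_le_eq)
    ultimately have "z \<in> closed_segment z1 z2"
      unfolding closed_segment_def by blast
    then show False using z by simp
  qed
  have ne: "z \<noteq> z1" "z \<noteq> z2" if "z \<notin> closed_segment z1 z2" for z
    using that by auto
  show thesis
  proof
    show "continuous_on (- closed_segment z1 z2) (\<lambda>z. Ln (?q z))"
      using q ne by (auto intro!: continuous_intros)
    show "exp (Ln (?q z)) = ?q z" if "z \<notin> closed_segment z1 z2" for z
      using ne[OF that] by simp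
  qed
qed

section \<open>Complementary points close to each other\<close>

lemma continuous_logarithm_of_one_constant:
  assumes f: "continuous_on H f" "\<And>w. w \<in> H \<Longrightarrow> exp (f w) = (1::complex)"
    and uv: "connected_component H u v"
  shows "f u = f v"
proof -
  obtain T where T: "connected T" "T \<subseteq> H" "u \<in> T" "v \<in> T"
    using uv unfolding connected_component_def by blast
  have "f constant_on T"
  proof (rule continuous_discrete_range_constant[OF T(1)])
    show "continuous_on T f"
      using f(1) T(2) continuous_on_subset by blast
    fix x assume x: "x \<in> T"
    have "f y = f x" if "y \<in> T" "norm (f y - f x) < 2 * pi" for y
    proof (rule exp_complex_eqI)
      show "\<bar>Im (f y) - Im (f x)\<bar> < 2 * pi"
        using that(2) abs_Im_le_cmod[of "f y - f x"] by simp
      show "exp (f y) = exp (f x)"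
        using f(2) that(1) x T(2) by (metis subsetD)
    qed
    then show "\<exists>e>0. \<forall>y. y \<in> T \<and> f y \<noteq> f x \<longrightarrow> e \<le> norm (f y - f x)"
      by (intro exI[of _ "2 * pi"]) (auto simp: not_less[symmetric])
  qed
  then show ?thesis
    using T unfolding constant_on_def by auto
qed

text \<open>Let \<open>H\<close> be the part of \<open>\<Omega>\<close> in the disc of radius \<open>R\<close> that is not on the segment from \<open>z1\<close> to \<open>z2\<close>.
  On \<open>H\<close> the logarithms \<open>g0\<close> of \<open>(z - z1) / (z - z2)\<close>, defined off the segment, and \<open>g1\<close>, \<open>g2\<close> of
  \<open>z - z1\<close> and \<open>z - z2\<close>, defined off the components \<open>S1\<close> and \<open>S2\<close>, satisfy \<open>g0 = g1 - g2 + f\<close> with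
  \<open>f\<close> locally constant. As \<open>x\<close> moves in \<open>\<Omega>\<close> within the disc of radius \<open>2 r\<close>, even across the segment, its
  roomy point at scale \<open>s\<close> stays in one component of \<open>H\<close>, since uniform curves between roomy points
  avoid the segment. So the value of \<open>f\<close> does not jump at the segment, and \<open>g1 - g2 + f\<close>
  extends \<open>g0\<close> from the outside of the disc of radius \<open>r\<close> to all of \<open>\<Omega>\<close>.

  The constants: \<open>s / A = (A + 2) d\<close> exceeds the distance \<open>(A + 1) d\<close> to \<open>z1\<close> within which a
  uniform curve meeting the segment has an endpoint; \<open>r = s + d\<close> keeps curves of length \<open>s\<close> from the
  outside of the disc of radius \<open>r\<close> off the segment; \<open>R = 8 A r\<close> leaves space for
  uniform curves of length \<open>3 A s\<close>.\<close>
lemma connected_component_localize: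
  fixes A d :: real
  defines "r \<equiv> (A + 1)^2 * d" and "R \<equiv> 8 * A * (A + 1)^2 * d"
  assumes iu: "inner_uniform A \<Omega>" and z: "z1 \<notin> \<Omega>" "z2 \<notin> \<Omega>" "dist z1 z2 = d" "0 < d"
    and S1: "S1 \<in> components (- \<Omega>)" "z1 \<in> S1" "\<not> S1 \<subseteq> ball z1 R"
    and S2: "S2 \<in> components (- \<Omega>)" "z2 \<in> S2" "\<not> S2 \<subseteq> ball z1 R"
    and big: "\<not> \<Omega> \<subseteq> ball z1 R"
  shows "connected_component (- \<Omega> \<inter> cball z1 r) z1 z2"
proof -
  have A: "A \<ge> 1" and op: "open \<Omega>"
    using iu by (auto simp: inner_uniform_def plane_domain_def)
  define s where "s = A * (A + 2) * d"
  have s: "0 < s" "s / A = (A + 2) * d" "r = s + d"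
    using A z(4) unfolding s_def r_def power2_eq_square
    by (simp, simp, simp add: algebra_simps)
  have R: "R = 8 * (A * r)"
    by (simp add: R_def r_def)
  have r0: "0 < r" "s \<le> r" "d \<le> r" "r \<le> A * r" "A * s \<le> A * r"
    using s z(4) A by (auto intro: mult_left_mono)
  define V where "V = \<Omega> \<inter> ball z1 (2 * r)"
  define H where "H = \<Omega> \<inter> ball z1 R - closed_segment z1 z2"
  obtain q where q: "q \<in> \<Omega>" "R \<le> dist z1 q"
    using big by (auto simp: subset_iff not_less)
  have "\<exists>g. linked \<Omega> s x g \<and> ball g (s / A) \<subseteq> \<Omega>" if x: "x \<in> V" for x
  proof -
    have "dist z1 x < 2 * r"
      using x by (auto simp: V_def)
    then have "3 * s \<le> dist x q"
      using q(2) r0 R dist_triangle[of z1 q x] by linarith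
    then show ?thesis
      using roomy_point[OF iu _ q(1), of x s] x s(1) by (auto simp: V_def)
  qed
  then obtain g where g: "\<And>x. x \<in> V \<Longrightarrow> linked \<Omega> s x (g x)" "\<And>x. x \<in> V \<Longrightarrow> ball (g x) (s / A) \<subseteq> \<Omega>"
    by metis
  have seg: "dist z1 p \<le> d" if "p \<in> closed_segment z1 z2" for p
    using dist_in_closed_segment[OF that] z(3) by (simp add: dist_commute)
  have far: "(A + 2) * d \<le> dist (g x) z1" if "x \<in> V" for x
    using g(2)[OF that] z(1) s(2) by (force simp: subset_iff not_less[symmetric])
  \<comment> \<open>A uniform curve that meets the segment does so close to one of its endpoints, whereas
    \<open>z1\<close> is far away from both endpoints.\<close>
  have linkH: "connected_component H (g x) (g y)" if x: "x \<in> V" and y: "y \<in> V" and xy: "linked \<Omega> s x y" for x y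
  proof -
    have "linked \<Omega> (s + s + s) (g x) (g y)"
      using linked_trans[OF linked_trans[OF linked_sym[OF g(1)[OF x]] xy] g(1)[OF y]] s(1) by simp
    then obtain \<gamma> where \<gamma>: "joins_in \<Omega> (g x) (g y) \<gamma>" "curve_length \<gamma> 0 1 \<le> ennreal (A * (s + s + s))"
      "\<And>t e. t \<in> {0..1} \<Longrightarrow> e \<notin> \<Omega> \<Longrightarrow>
        curve_length \<gamma> 0 t \<le> ennreal (A * dist (\<gamma> t) e) \<or> curve_length \<gamma> t 1 \<le> ennreal (A * dist (\<gamma> t) e)"
      using inner_uniform_curve[OF iu] s(1) by (metis add_pos_pos less_imp_le)
    have "p \<in> H" if p: "p \<in> path_image \<gamma>" for p
    proof -
      obtain t where t: "t \<in> {0..1}" "p = \<gamma> t"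
        using p by (auto simp: path_image_def)
      have "dist (g x) p \<le> A * (s + s + s)"
        using path_image_subset_cball[OF \<gamma>(1,2)] p A s(1) by auto
      moreover have "dist x (g x) \<le> s"
        using linked_dist_le[OF g(1)[OF x]] s(1) by simp
      moreover have "dist z1 x < 2 * r"
        using x by (auto simp: V_def)
      ultimately have "dist z1 p < R"
        using R r0 dist_triangle[of z1 p x] dist_triangle[of x p "g x"] unfolding distrib_left by linarith
      moreover have "p \<notin> closed_segment z1 z2"
      proof
        assume "p \<in> closed_segment z1 z2"
        then have pd: "dist z1 p \<le> d" by (rule seg)
        then have Ad: "A * dist (\<gamma> t) z1 \<le> A * d" "0 \<le> A * dist (\<gamma> t) z1"
          using A t(2) by (auto simp: dist_commute)
        have "dist (g x) p \<le> A * d \<or> dist p (g y) \<le> A * d"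
          using \<gamma>(3)[OF t(1) z(1)] dist_start_le_curve_length[OF \<gamma>(1) t(1) _ Ad(2)]
            dist_finish_le_curve_length[OF \<gamma>(1) t(1) _ Ad(2)] Ad(1) t(2) by fastforce
        then show False
          using far[OF x] far[OF y] pd z(4) dist_triangle[of "g x" z1 p] dist_triangle[of "g y" z1 p]
          by (auto simp: algebra_simps dist_commute)
      qed
      ultimately show ?thesis
        using \<gamma>(1) p by (auto simp: H_def joins_in_def)
    qed
    then show ?thesis
      unfolding connected_component_def
      using \<gamma>(1) pathstart_in_path_image[of \<gamma>] pathfinish_in_path_image[of \<gamma>]
      by (intro exI[of _ "path_image \<gamma>"]) (auto simp: joins_in_def connected_path_image)
  qed
  have linkH': "connected_component H u (g u)" if u: "u \<in> V" and far_u: "r < dist z1 u" for u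
  proof -
    obtain \<gamma> where \<gamma>: "joins_in \<Omega> u (g u) \<gamma>" "curve_length \<gamma> 0 1 \<le> ennreal s"
      using g(1)[OF u] unfolding linked_def by blast
    have "p \<in> H" if p: "p \<in> path_image \<gamma>" for p
    proof -
      have up: "dist u p \<le> s"
        using path_image_subset_cball[OF \<gamma>] p s(1) by auto
      moreover have "dist z1 u < 2 * r"
        using u by (auto simp: V_def)
      ultimately have "dist z1 p < R"
        using R r0 dist_triangle[of z1 p u] by linarith
      moreover have "d < dist z1 p"
        using up far_u s(3) dist_triangle[of z1 u p] by (simp add: dist_commute)
      ultimately show ?thesis
        using \<gamma>(1) p seg[of p] by (auto simp: H_def joins_in_def)
    qed
    then show ?thesis
      unfolding connected_component_def
      using \<gamma>(1) pathstart_in_path_image[of \<gamma>] pathfinish_in_path_image[of \<gamma>]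
      by (intro exI[of _ "path_image \<gamma>"]) (auto simp: joins_in_def connected_path_image)
  qed
  have cl: "closed S1" "closed S2" "connected S1" "connected S2" and disj: "\<Omega> \<inter> S1 = {}" "\<Omega> \<inter> S2 = {}"
    using closed_components[of "- \<Omega>"] S1(1) S2(1) op in_components_connected in_components_subset by fastforce+
  obtain g1 where g1: "continuous_on (ball z1 R - S1) g1" "\<And>w. w \<in> ball z1 R - S1 \<Longrightarrow> exp (g1 w) = w - z1"
    by (rule logarithm_on_ball_minus_connected[OF cl(1,3) S1(2,3)]) blast
  obtain g2 where g2: "continuous_on (ball z1 R - S2) g2" "\<And>w. w \<in> ball z1 R - S2 \<Longrightarrow> exp (g2 w) = w - z2"
    by (rule logarithm_on_ball_minus_connected[OF cl(2,4) S2(2,3)]) blast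
  obtain g0 where g0: "continuous_on (- closed_segment z1 z2) g0"
    "\<And>w. w \<notin> closed_segment z1 z2 \<Longrightarrow> exp (g0 w) = (w - z1) / (w - z2)"
    by (rule logarithm_off_segment[of z1 z2]) blast
  define f where "f w = g0 w - g1 w + g2 w" for w
  have Hsub: "H \<subseteq> ball z1 R - S1" "H \<subseteq> ball z1 R - S2" "H \<subseteq> - closed_segment z1 z2"
    using disj by (auto simp: H_def)
  have "continuous_on H f"
    unfolding f_def by (intro continuous_intros continuous_on_subset[OF g0(1) Hsub(3)]
        continuous_on_subset[OF g1(1) Hsub(1)] continuous_on_subset[OF g2(1) Hsub(2)])
  moreover have expf: "exp (f w) = 1" if "w \<in> H" for w
  proof -
    have "w \<noteq> z1" "w \<noteq> z2" using that Hsub by auto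
    then show ?thesis
      using g0(2)[of w] g1(2)[of w] g2(2)[of w] that Hsub
      by (auto simp: f_def exp_add exp_diff subset_iff)
  qed
  ultimately have fconst: "f u = f v" if "connected_component H u v" for u v
    using continuous_logarithm_of_one_constant that by blast
  \<comment> \<open>On \<open>V\<close>, the values of \<open>f\<close> at roomy points are a locally constant substitute for \<open>f\<close> itself,
    which is only defined off the segment.\<close>
  define L where "L w = (if r < dist z1 w then g0 w else g1 w - g2 w + f (g w))" for w
  have LV: "L w = g1 w - g2 w + f (g w)" if w: "w \<in> V" for w
  proof (cases "r < dist z1 w")
    case True
    have fw: "f (g w) = f w"
      using fconst[OF linkH'[OF w True]] by simp
    show ?thesis
      unfolding fw using True by (simp add: L_def f_def)
  qed (simp add: L_def)
  have VR: "V \<subseteq> ball z1 R - S1" "V \<subseteq> ball z1 R - S2"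
  proof -
    have "2 * r \<le> R" using R r0 by linarith
    then show "V \<subseteq> ball z1 R - S1" "V \<subseteq> ball z1 R - S2"
      using disj by (auto simp: V_def)
  qed
  have opV: "open V"
    using op by (auto simp: V_def)
  have "continuous_on V (\<lambda>w. f (g w))"
    unfolding continuous_on_iff
  proof (intro ballI allI impI)
    fix x and e :: real assume x: "x \<in> V" and "0 < e"
    obtain \<delta> where \<delta>: "\<delta> > 0" "ball x \<delta> \<subseteq> V"
      using opV x open_contains_ball by blast
    have "f (g y) = f (g x)" if y: "y \<in> V" "dist y x < min \<delta> s" for y
    proof -
      have "closed_segment x y \<subseteq> ball x \<delta>"
        using y \<delta> by (intro closed_segment_subset) (auto simp: dist_commute)
      then have "linked \<Omega> s x y"
        using \<delta>(2) y(2) by (intro linked_segment) (auto simp: V_def dist_commute)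
      then show ?thesis
        using fconst[OF linkH[OF x y(1)]] by simp
    qed
    then show "\<exists>da>0. \<forall>y\<in>V. dist y x < da \<longrightarrow> dist (f (g y)) (f (g x)) < e"
      using \<delta>(1) s(1) \<open>0 < e\<close> by (intro exI[of _ "min \<delta> s"]) auto
  qed
  then have "continuous_on V (\<lambda>w. g1 w - g2 w + f (g w))"
    by (intro continuous_intros continuous_on_subset[OF g1(1) VR(1)] continuous_on_subset[OF g2(1) VR(2)])
  then have "continuous_on V L"
    using LV by (metis (no_types, lifting) continuous_on_cong)
  moreover have out: "- cball z1 r \<subseteq> - closed_segment z1 z2"
    using seg r0 by fastforce
  have "continuous_on (- cball z1 r) g0"
    using continuous_on_subset[OF g0(1) out] .
  then have "continuous_on (- cball z1 r) L"
    by (rule continuous_on_eq) (simp add: L_def)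
  moreover have Fc: "- (- \<Omega> \<inter> cball z1 r) = V \<union> - cball z1 r"
    using r0(1) by (auto simp: V_def)
  ultimately have contL: "continuous_on (- (- \<Omega> \<inter> cball z1 r)) L"
    using opV by (metis continuous_on_open_Un open_Compl closed_cball)
  show ?thesis
  proof (rule connected_component_of_logarithm[OF _ _ _ contL])
    show "compact (- \<Omega> \<inter> cball z1 r)"
      using op by (metis closed_Compl closed_Int_compact compact_cball)
    show "z1 \<in> - \<Omega> \<inter> cball z1 r" "z2 \<in> - \<Omega> \<inter> cball z1 r"
      using z r0 by auto
    fix w assume "w \<notin> - \<Omega> \<inter> cball z1 r"
    then consider "w \<in> V" | "w \<in> - cball z1 r"
      using Fc by blast
    then show "exp (L w) = (w - z1) / (w - z2)"
    proof cases
      case 1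
      have "linked \<Omega> s w w"
        using 1 s(1) by (intro linked_refl) (auto simp: V_def)
      then have "g w \<in> H"
        using linkH[OF 1 1] connected_component_in by blast
      then have "exp (f (g w)) = 1" by (rule expf)
      moreover have "exp (g1 w) = w - z1" "exp (g2 w) = w - z2"
        using g1(2) g2(2) VR 1 by blast+
      ultimately show ?thesis
        using LV[OF 1] by (simp add: exp_add exp_diff)
    next
      case 2
      then have "w \<notin> closed_segment z1 z2"
        using out by blast
      then show ?thesis
        using g0(2) 2 by (simp add: L_def)
    qed
  qed
qed

section \<open>Separation and bounded turning of the complementary components\<close>

lemma ediameter_le_cball:
  assumes "S \<subseteq> cball c R" "0 \<le> R"
  shows "ediameter S \<le> ennreal (2 * R)"
proof -
  have "dist x y \<le> 2 * R" if "x \<in> S" "y \<in> S" for x y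
  proof -
    have "dist c x \<le> R" "dist c y \<le> R" using that assms(1) by auto
    then show ?thesis using dist_triangle3[of x y c] by linarith
  qed
  then show ?thesis
    unfolding ediameter_def by (auto intro!: SUP_least ennreal_leI)
qed

lemma dist_le_ediameter:
  assumes "x \<in> S" "y \<in> S"
  shows "ennreal (dist x y) \<le> ediameter S"
  unfolding ediameter_def by (rule SUP_upper2[OF assms(1)], rule SUP_upper[OF assms(2)])

lemma exterior_of_ball_subset_component:
  fixes \<Omega> :: "complex set"
  assumes "\<Omega> \<subseteq> ball z R" "S \<in> components (- \<Omega>)" "\<not> S \<subseteq> ball z R"
  shows "- ball z R \<subseteq> S"
proof (rule components_maximal[OF assms(2)])
  show "connected (- ball z R)"
    by (intro connected_complement_bounded_convex) auto
qed (use assms in auto)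

text \<open>Localization would put the two points into the same complementary component. If \<open>\<Omega>\<close> lies in the
  disc, there may be no roomy points, but then both components would contain the exterior of the disc.\<close>
lemma components_in_ball:
  fixes A :: real
  assumes iu: "inner_uniform A \<Omega>" and S: "S1 \<in> components (- \<Omega>)" "S2 \<in> components (- \<Omega>)" "S1 \<noteq> S2"
    and z: "z1 \<in> S1" "z2 \<in> S2"
  defines "R \<equiv> 8 * A * (A + 1)^2 * dist z1 z2"
  shows "S1 \<subseteq> ball z1 R \<or> S2 \<subseteq> ball z1 R"
proof (rule ccontr)
  assume neg: "\<not> (S1 \<subseteq> ball z1 R \<or> S2 \<subseteq> ball z1 R)"
  have disj: "S1 \<inter> S2 = {}"
    using S components_nonoverlap by blast
  then have "z1 \<noteq> z2" using z by auto
  have out: "z1 \<notin> \<Omega>" "z2 \<notin> \<Omega>"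
    using S z in_components_subset by blast+
  show False
  proof (cases "\<Omega> \<subseteq> ball z1 R")
    case True
    have "- ball z1 R \<subseteq> S1 \<inter> S2"
      using exterior_of_ball_subset_component[OF True] S neg by blast
    moreover have "- ball z1 R \<noteq> {}"
      by (metis Compl_empty_eq Compl_eq_Compl_iff bounded_ball double_complement not_bounded_UNIV)
    ultimately show False
      using disj by auto
  next
    case False
    have "connected_component (- \<Omega> \<inter> cball z1 ((A + 1)^2 * dist z1 z2)) z1 z2"
      by (rule connected_component_localize[OF iu out refl _ S(1) z(1) _ S(2) z(2)])
         (use neg False \<open>z1 \<noteq> z2\<close> in \<open>auto simp: R_def\<close>)
    then obtain T where "connected T" "T \<subseteq> - \<Omega>" "z1 \<in> T" "z2 \<in> T"
      unfolding connected_component_def by blast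
    then have "z2 \<in> S1"
      using components_maximal[OF S(1)] z(1) by blast
    then show False
      using disj z(2) by auto
  qed
qed

lemma components_relatively_separated:
  fixes A :: real
  assumes iu: "inner_uniform A \<Omega>" and S: "S1 \<in> components (- \<Omega>)" "S2 \<in> components (- \<Omega>)" "S1 \<noteq> S2"
    and z: "z1 \<in> S1" "z2 \<in> S2"
  shows "min (ediameter S1) (ediameter S2) \<le> ennreal (16 * A * (A + 1)^2 * dist z1 z2)"
proof -
  let ?R = "8 * A * (A + 1)^2 * dist z1 z2"
  have "0 \<le> ?R"
    using iu by (auto simp: inner_uniform_def)
  moreover have "S1 \<subseteq> cball z1 ?R \<or> S2 \<subseteq> cball z1 ?R"
    using components_in_ball[OF assms] ball_subset_cball by blast
  ultimately have "ediameter S1 \<le> ennreal (2 * ?R) \<or> ediameter S2 \<le> ennreal (2 * ?R)"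
    using ediameter_le_cball by blast
  then show ?thesis
    by (auto simp: min_le_iff_disj mult.assoc)
qed

text \<open>The nearest-point retraction onto the disc moves points outside it to the bounding circle, which
  lies in \<open>S\<close>; so it maps \<open>S\<close> onto the intersection.\<close>
lemma connected_Int_cball:
  fixes S :: "complex set"
  assumes "connected S" "- ball c R \<subseteq> S" "0 < R"
  shows "connected (S \<inter> cball c R)"
proof -
  let ?p = "closest_point (cball c R)"
  have "?p ` S = S \<inter> cball c R"
  proof
    show "?p ` S \<subseteq> S \<inter> cball c R"
    proof
      fix w assume "w \<in> ?p ` S"
      then obtain x where x: "x \<in> S" "w = ?p x" by auto
      have w: "w \<in> cball c R"
        using x(2) closest_point_in_set[of "cball c R" x] assms(3) by auto
      have "w \<in> S"
      proof (cases "x \<in> cball c R")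
        case True
        then show ?thesis using x closest_point_self by metis
      next
        case False
        have int: "interior (cball c R) \<noteq> {}"
          using assms(3) by simp
        then have "rel_interior (cball c R) = ball c R" "affine hull (cball c R) = UNIV"
          using rel_interior_nonempty_interior[OF int] affine_hull_nonempty_interior[OF int] by simp_all
        then have "w \<notin> ball c R"
          unfolding x(2) using False closest_point_in_rel_interior[of "cball c R" x] assms(3) by auto
        then show ?thesis
          using w assms(2) by auto
      qed
      then show "w \<in> S \<inter> cball c R" using w by blast
    qed
    show "S \<inter> cball c R \<subseteq> ?p ` S"
      using closest_point_self by (metis IntE image_eqI subsetI)
  qed
  moreover have "continuous_on S ?p"
    using assms(3) by (intro continuous_on_closest_point) auto
  ultimately show ?thesis
    using connected_continuous_image assms(1) by metis
qed

text \<open>If \<open>S\<close> is small or surrounds \<open>\<Omega>\<close> at scale \<open>R\<close>, it provides a small connected set itself, in the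
  second case after truncation; otherwise localization applies to two points of \<open>S\<close>.\<close>
lemma component_bounded_turning:
  fixes A :: real
  assumes iu: "inner_uniform A \<Omega>" and S: "S \<in> components (- \<Omega>)"
  shows "bounded_turning (16 * A * (A + 1)^2) S"
  unfolding bounded_turning_def
proof (intro conjI ballI)
  have A: "A \<ge> 1"
    using iu by (auto simp: inner_uniform_def)
  have A1: "1 \<le> (A + 1)^2"
    using A by (intro one_le_power) auto
  have A2: "(A + 1)^2 \<le> A * (A + 1)^2" "1 \<le> A * (A + 1)^2"
    using A A1 mult_mono[of 1 A "(A + 1)^2" "(A + 1)^2"] mult_mono[of 1 A 1 "(A + 1)^2"] by auto
  then show "1 \<le> 16 * A * (A + 1)^2"
    by simp
  fix x y assume x: "x \<in> S" and y: "y \<in> S"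
  define d where "d = dist x y"
  define R where "R = 8 * A * (A + 1)^2 * d"
  have Rd: "0 \<le> R" "d \<le> R" "(A + 1)^2 * d \<le> R"
    using A2 mult_right_mono[of 1 "8 * A * (A + 1)^2" d] mult_right_mono[of "(A + 1)^2" "8 * A * (A + 1)^2" d]
    by (auto simp: R_def d_def)
  have small: "\<exists>E\<subseteq>S. connected E \<and> x \<in> E \<and> y \<in> E \<and> ediameter E \<le> ennreal (16 * A * (A + 1)^2) * ennreal (dist x y)"
    if E: "E \<subseteq> S" "connected E" "x \<in> E" "y \<in> E" "E \<subseteq> cball x R" for E
  proof -
    have "ediameter E \<le> ennreal (2 * R)"
      using E(5) Rd(1) by (rule ediameter_le_cball)
    also have "\<dots> = ennreal (16 * A * (A + 1)^2) * ennreal (dist x y)"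
      using A by (simp add: R_def d_def ennreal_mult[symmetric] mult.assoc)
    finally show ?thesis
      using E by blast
  qed
  have conn: "connected S" and sub: "S \<subseteq> - \<Omega>"
    using S in_components_connected in_components_subset by blast+
  consider "x = y" | "S \<subseteq> ball x R" | "x \<noteq> y" "\<not> S \<subseteq> ball x R" "\<Omega> \<subseteq> ball x R"
    | "x \<noteq> y" "\<not> S \<subseteq> ball x R" "\<not> \<Omega> \<subseteq> ball x R"
    by blast
  then show "\<exists>E\<subseteq>S. connected E \<and> x \<in> E \<and> y \<in> E \<and> ediameter E \<le> ennreal (16 * A * (A + 1)^2) * ennreal (dist x y)"
  proof cases
    case 1
    then show ?thesis using x Rd by (intro small[of "{x}"]) auto
  next
    case 2
    then show ?thesis using x y conn by (intro small[of S]) auto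
  next
    case 3
    have "- ball x R \<subseteq> S"
      using exterior_of_ball_subset_component[OF 3(3) S 3(2)] .
    moreover have "0 < R"
      using 3(1) Rd(2) by (simp add: d_def less_le_trans[of 0 "dist x y"])
    ultimately show ?thesis
      using x y Rd connected_Int_cball[OF conn] by (intro small[of "S \<inter> cball x R"]) (auto simp: d_def)
  next
    case 4
    have "connected_component (- \<Omega> \<inter> cball x ((A + 1)^2 * d)) x y"
      by (rule connected_component_localize[OF iu _ _ d_def[symmetric] _ S x _ S y])
         (use 4 sub x y in \<open>auto simp: R_def d_def\<close>)
    then obtain T where T: "connected T" "T \<subseteq> - \<Omega>" "T \<subseteq> cball x ((A + 1)^2 * d)" "x \<in> T" "y \<in> T"
      unfolding connected_component_def by blast
    have "T \<subseteq> S"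
      using components_maximal[OF S T(1,2)] T(4) x by blast
    moreover have "T \<subseteq> cball x R"
      using T(3) Rd(3) by auto
    ultimately show ?thesis
      using T by (intro small[of T]) auto
  qed
qed

section \<open>Filling complementary components\<close>

text \<open>Points chosen from different large components are separated by a fixed distance, and the
  complement is compact.\<close>
lemma finite_large_components:
  fixes A \<delta> :: real
  assumes iu: "inner_uniform A \<Omega>" and cpt: "compact (- \<Omega>)" and "0 < \<delta>"
  shows "finite {S \<in> components (- \<Omega>). ennreal \<delta> \<le> ediameter S}" (is "finite ?F")
proof -
  define C where "C = 16 * A * (A + 1)^2"
  have "C > 0"
    using iu by (auto simp: C_def inner_uniform_def)
  define p :: "complex set \<Rightarrow> complex" where "p S = (SOME x. x \<in> S)" for S
  have p: "p S \<in> S" if "S \<in> ?F" for S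
    unfolding p_def using that in_components_nonempty by (auto intro: some_in_eq[THEN iffD2])
  have sep: "\<delta> \<le> C * dist (p S) (p T)" if "S \<in> ?F" "T \<in> ?F" "S \<noteq> T" for S T
  proof -
    have "ennreal \<delta> \<le> min (ediameter S) (ediameter T)"
      using that by auto
    also have "\<dots> \<le> ennreal (C * dist (p S) (p T))"
      unfolding C_def using components_relatively_separated[OF iu] p that by blast
    finally show ?thesis
      using \<open>C > 0\<close> by simp
  qed
  have "0 < \<delta> / (2 * C)"
    using \<open>0 < \<delta>\<close> \<open>C > 0\<close> by simp
  then obtain k where k: "finite k" "- \<Omega> \<subseteq> (\<Union>x\<in>k. ball x (\<delta> / (2 * C)))"
    using cpt unfolding compact_eq_totally_bounded by blast
  have "\<forall>S\<in>?F. \<exists>c. c \<in> k \<and> p S \<in> ball c (\<delta> / (2 * C))"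
  proof
    fix S assume S: "S \<in> ?F"
    then have "p S \<in> - \<Omega>"
      using p[OF S] in_components_subset by blast
    then show "\<exists>c. c \<in> k \<and> p S \<in> ball c (\<delta> / (2 * C))"
      using k(2) by blast
  qed
  from bchoice[OF this] obtain c
    where c: "\<And>S. S \<in> ?F \<Longrightarrow> c S \<in> k" "\<And>S. S \<in> ?F \<Longrightarrow> p S \<in> ball (c S) (\<delta> / (2 * C))"
    by blast
  have "inj_on c ?F"
  proof (rule inj_onI, rule ccontr)
    fix S T assume ST: "S \<in> ?F" "T \<in> ?F" "c S = c T" "S \<noteq> T"
    have "dist (c S) (p S) < \<delta> / (2 * C)" "dist (c S) (p T) < \<delta> / (2 * C)"
      using c(2)[OF ST(1)] c(2)[OF ST(2)] ST(3) by auto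
    then have "dist (p S) (p T) < \<delta> / C"
      using dist_triangle3[of "p S" "p T" "c S"] by simp
    then have "C * dist (p S) (p T) < \<delta>"
      using \<open>C > 0\<close> by (simp add: field_simps)
    then show False
      using sep[OF ST(1,2,4)] by simp
  qed
  then show ?thesis
    using c(1) k(1) by (meson finite_imageD finite_subset image_subsetI)
qed

lemma finite_components_Union_connected:
  fixes F :: "'a::topological_space set set"
  assumes "finite F" "\<And>S. S \<in> F \<Longrightarrow> connected S"
  shows "finite (components (\<Union>F))"
proof -
  have "components (\<Union>F) \<subseteq> (\<lambda>S. connected_component_set (\<Union>F) (SOME x. x \<in> S)) ` F"
  proof
    fix K assume "K \<in> components (\<Union>F)"
    then obtain x where x: "x \<in> \<Union>F" "K = connected_component_set (\<Union>F) x"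
      unfolding components_iff by blast
    then obtain S where S: "S \<in> F" "x \<in> S" by blast
    have "(SOME x. x \<in> S) \<in> S"
      using S(2) by (rule someI)
    then have "connected_component (\<Union>F) x (SOME x. x \<in> S)"
      unfolding connected_component_def using S assms(2) by (intro exI[of _ S]) auto
    then show "K \<in> (\<lambda>S. connected_component_set (\<Union>F) (SOME x. x \<in> S)) ` F"
      using S(1) x(2) connected_component_eq by (intro image_eqI[of _ _ S]) fastforce+
  qed
  then show ?thesis
    using assms(1) finite_surj by blast
qed

text \<open>A connected set \<open>S\<close> at distance \<open>D\<close> from \<open>E\<close> and of diameter at most a multiple of \<open>D\<close> can be
  traversed by a polygon with vertices in \<open>S\<close>, sides shorter than \<open>D / 4\<close> and a bounded
  number of sides, which stays far away from \<open>E\<close>.\<close>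
lemma linked_out_of_connected_set:
  fixes M :: real
  obtains N :: nat where
    "\<And>S E D a p y. \<lbrakk>connected S; 0 < D; \<And>x e. x \<in> S \<Longrightarrow> e \<in> E \<Longrightarrow> D \<le> dist x e;
       \<And>x y. x \<in> S \<Longrightarrow> y \<in> S \<Longrightarrow> dist x y \<le> M * D; a \<in> S; p \<in> S; dist p y < D / 4\<rbrakk> \<Longrightarrow>
       linked {z. \<forall>e\<in>E. 3 / 4 * D \<le> dist z e} (real N * D) a (y::complex)"
proof -
  obtain N :: nat where N:
    "\<And>X f U c \<delta> K x y. \<lbrakk>connected X; 0 < \<delta>; 0 \<le> K; \<And>x. x \<in> X \<Longrightarrow> dist c (f x) \<le> 4 * M * \<delta>;
      \<And>x. x \<in> X \<Longrightarrow> \<exists>T. open T \<and> x \<in> T \<and> (\<forall>y\<in>X \<inter> T. linked U K (f x) (f y));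
      \<And>x y. x \<in> X \<Longrightarrow> y \<in> X \<Longrightarrow> dist (f x) (f y) < \<delta> \<Longrightarrow> linked U K (f x) (f y);
      x \<in> X; y \<in> X\<rbrakk> \<Longrightarrow> linked U (real N * K) (f (x::complex)) (f y)"
    by (rule linked_along_connected_set[of "4 * M"]) blast
  have key: "linked {z. \<forall>e\<in>E. 3 / 4 * D \<le> dist z e} (real (N + 1) * D) a y"
    if S: "connected S" "0 < D" "\<And>x e. x \<in> S \<Longrightarrow> e \<in> E \<Longrightarrow> D \<le> dist x e"
       "\<And>x y. x \<in> S \<Longrightarrow> y \<in> S \<Longrightarrow> dist x y \<le> M * D" and ap: "a \<in> S" "p \<in> S" "dist p y < D / 4" for S E D a p y
  proof -
    let ?U = "{z. \<forall>e\<in>E. 3 / 4 * D \<le> dist z e}"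
    have near: "linked ?U (D / 4) x y" if x: "x \<in> S" and xy: "dist x y < D / 4" for x y
    proof (rule linked_segment)
      show "closed_segment x y \<subseteq> ?U"
      proof
        fix z assume "z \<in> closed_segment x y"
        then have "dist z x < D / 4"
          using dist_in_closed_segment xy by fastforce
        then have "3 / 4 * D \<le> dist z e" if "e \<in> E" for e
          using S(3)[OF x that] dist_triangle[of x e z] by (simp add: dist_commute)
        then show "z \<in> ?U" by blast
      qed
    qed (use xy in simp)
    have "linked ?U (real N * (D / 4)) a p"
    proof (rule N[OF S(1), where \<delta> = "D / 4" and c = a and f = "\<lambda>x. x"])
      fix x assume x: "x \<in> S"
      show "dist a x \<le> 4 * M * (D / 4)"
        using S(4)[OF ap(1) x] by simp
      show "\<exists>T. open T \<and> x \<in> T \<and> (\<forall>y\<in>S \<inter> T. linked ?U (D / 4) x y)"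
        using near[OF x] S(2) by (intro exI[of _ "ball x (D / 4)"]) auto
    qed (use near S(2) ap in auto)
    then have lk: "linked ?U (real N * (D / 4) + D / 4) a y"
      using linked_trans[OF _ near[OF ap(2,3)], of "real N * (D / 4)" a] S(2) by simp
    have "0 \<le> real N * D" "real (N + 1) * D = real N * D + D"
      using S(2) by (simp_all add: distrib_right)
    then have "real N * (D / 4) + D / 4 \<le> real (N + 1) * D"
      using S(2) by linarith
    then show ?thesis
      by (rule linked_mono[OF lk order_refl])
  qed
  show thesis
    by (rule that[of "N + 1"]) (fact key)
qed

text \<open>Link the roomy points at scale \<open>s\<close> of nearby points of \<open>X\<close>, and those in a common disc of radius
  \<open>s / A\<close> contained in \<open>\<Omega>\<close>; then shorten chains. The hypothesis that \<open>\<Omega>\<close> is unbounded guarantees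
  roomy points at every scale.\<close>
lemma linked_in_connected_region:
  fixes A M :: real
  obtains N :: nat where
    "\<And>\<Omega> X c s x y. \<lbrakk>inner_uniform A \<Omega>; \<not> bounded \<Omega>; connected X; X \<subseteq> \<Omega>; X \<subseteq> cball c (M * s); 0 < s;
       x \<in> X; y \<in> X\<rbrakk> \<Longrightarrow> linked \<Omega> (real N * s) x y"
proof -
  obtain N :: nat where N:
    "\<And>X f U c \<delta> K x y. \<lbrakk>connected X; 0 < \<delta>; 0 \<le> K; \<And>x. x \<in> X \<Longrightarrow> dist c (f x) \<le> A * (M + 1) * \<delta>;
      \<And>x. x \<in> X \<Longrightarrow> \<exists>T. open T \<and> x \<in> T \<and> (\<forall>y\<in>X \<inter> T. linked U K (f x) (f y));
      \<And>x y. x \<in> X \<Longrightarrow> y \<in> X \<Longrightarrow> dist (f x) (f y) < \<delta> \<Longrightarrow> linked U K (f x) (f y);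
      x \<in> X; y \<in> X\<rbrakk> \<Longrightarrow> linked U (real N * K) (f (x::complex)) (f y)"
    by (rule linked_along_connected_set[of "A * (M + 1)"]) blast
  have key: "linked \<Omega> (real (3 * N + 2) * s) x y"
    if iu: "inner_uniform A \<Omega>" and unb: "\<not> bounded \<Omega>" and X: "connected X" "X \<subseteq> \<Omega>" "X \<subseteq> cball c (M * s)"
      and s: "0 < s" and xy: "x \<in> X" "y \<in> X" for \<Omega> X c s x y
  proof -
    have A: "A \<ge> 1" and op: "open \<Omega>"
      using iu by (auto simp: inner_uniform_def plane_domain_def)
    obtain q where q: "q \<in> \<Omega>" "(M + 3) * s < dist c q"
      using unb unfolding bounded_def by (metis not_le)
    have cx: "dist c x \<le> M * s" if "x \<in> X" for x
      using that X(3) by auto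
    have "\<exists>g. linked \<Omega> s x g \<and> ball g (s / A) \<subseteq> \<Omega>" if x: "x \<in> X" for x
    proof -
      have "3 * s \<le> dist x q"
        using cx[OF x] q(2) dist_triangle[of c q x] by (simp add: algebra_simps)
      then show ?thesis
        using roomy_point[OF iu _ q(1), of x s] x X(2) s by blast
    qed
    then obtain g where g: "\<And>x. x \<in> X \<Longrightarrow> linked \<Omega> s x (g x)" "\<And>x. x \<in> X \<Longrightarrow> ball (g x) (s / A) \<subseteq> \<Omega>"
      by metis
    have "linked \<Omega> (real N * (3 * s)) (g x) (g y)"
    proof (rule N[OF X(1), where \<delta> = "s / A" and c = c and f = g])
      fix x assume x: "x \<in> X"
      show "dist c (g x) \<le> A * (M + 1) * (s / A)"
        using cx[OF x] linked_dist_le[OF g(1)[OF x]] s A dist_triangle[of c "g x" x]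
        by (simp add: algebra_simps)
      obtain e where e: "e > 0" "ball x e \<subseteq> \<Omega>"
        using op x X(2) open_contains_ball by blast
      have "linked \<Omega> (3 * s) (g x) (g y)" if y: "y \<in> X" "dist x y < min e s" for y
      proof -
        have "closed_segment x y \<subseteq> ball x e"
          using e y by (intro closed_segment_subset) auto
        then have "linked \<Omega> s x y"
          using e(2) y(2) by (intro linked_segment) auto
        from linked_trans[OF linked_trans[OF linked_sym[OF g(1)[OF x]] this] g(1)[OF y(1)]]
        show ?thesis
          using s by simp
      qed
      then show "\<exists>T. open T \<and> x \<in> T \<and> (\<forall>y\<in>X \<inter> T. linked \<Omega> (3 * s) (g x) (g y))"
        using e(1) s by (intro exI[of _ "ball x (min e s)"]) auto
    next
      fix x y assume x: "x \<in> X" and y: "y \<in> X" and d: "dist (g x) (g y) < s / A"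
      have "closed_segment (g x) (g y) \<subseteq> ball (g x) (s / A)"
        using d s A by (intro closed_segment_subset) (auto intro: le_less_trans[OF zero_le_dist])
      moreover have "s / A \<le> 3 * s"
        using s A by (simp add: field_simps)
      ultimately show "linked \<Omega> (3 * s) (g x) (g y)"
        using g(2)[OF x] d by (intro linked_segment) auto
    qed (use s A xy in auto)
    then have "linked \<Omega> (s + real N * (3 * s) + s) x y"
      using linked_trans[OF linked_trans[OF g(1)[OF xy(1)]] linked_sym[OF g(1)[OF xy(2)]]] s by simp
    moreover have "s + real N * (3 * s) + s = real (3 * N + 2) * s"
      by (simp add: algebra_simps)
    ultimately show ?thesis by simp
  qed
  show thesis
    by (rule that[of "3 * N + 2"]) (fact key)
qed

text \<open>Let \<open>a\<close>, \<open>b\<close> be linked at cost \<open>L\<close> in the filled domain. If the linking curve has a point at distance at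
  least \<open>4 L\<close> from \<open>E\<close>, the segment from \<open>a\<close> to \<open>b\<close> is far from \<open>E\<close>. Otherwise a filled component
  met by the curve has distance \<open>D < 4 L\<close> from \<open>E\<close> and diameter at most a multiple of \<open>D\<close>. The
  new curve consists of a curve \<open>\<alpha>\<close> from \<open>a\<close> to a point \<open>y\<close> of \<open>\<Omega>\<close>, a uniform curve \<open>\<gamma>\<close> in \<open>\<Omega>\<close> from
  \<open>y\<close> to \<open>y'\<close>, and a curve \<open>\<beta>\<close> from \<open>y'\<close> to \<open>b\<close>. The length of \<open>\<alpha>\<close> is at most a multiple of \<open>D\<close>, and \<open>D\<close> in
  turn at most a multiple of the distance of \<open>y\<close> to \<open>E\<close>; so adding this length does not spoil the
  condition along \<open>\<gamma>\<close>.\<close>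
lemma inner_uniform_filled:
  fixes A C1 :: real
  assumes A: "A \<ge> 1" and C1: "C1 \<ge> 1"
  obtains C where "C \<ge> C1"
    "\<And>\<Omega> E. \<lbrakk>inner_uniform A \<Omega>; compact (- \<Omega>); closed E; E \<subseteq> - \<Omega>;
      \<And>S. S \<in> components (- \<Omega>) \<Longrightarrow> S \<inter> E \<noteq> {} \<Longrightarrow> S \<subseteq> E;
      \<And>S x y e. S \<in> components (- \<Omega>) \<Longrightarrow> S \<inter> E = {} \<Longrightarrow> x \<in> S \<Longrightarrow> y \<in> S \<Longrightarrow> e \<in> E \<Longrightarrow> dist x y \<le> C1 * dist x e\<rbrakk>
      \<Longrightarrow> inner_uniform C (- E)"
proof -
  obtain N1 :: nat where N1:
    "\<And>S E D a p y. \<lbrakk>connected S; 0 < D; \<And>x e. x \<in> S \<Longrightarrow> e \<in> E \<Longrightarrow> D \<le> dist x e;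
       \<And>x y. x \<in> S \<Longrightarrow> y \<in> S \<Longrightarrow> dist x y \<le> 2 * C1 * D; a \<in> S; p \<in> S; dist p y < D / 4\<rbrakk> \<Longrightarrow>
       linked {z. \<forall>e\<in>E. 3 / 4 * D \<le> dist z e} (real N1 * D) a (y::complex)"
    by (rule linked_out_of_connected_set[of "2 * C1"]) blast
  obtain N2 :: nat where N2:
    "\<And>\<Omega> X c s x y. \<lbrakk>inner_uniform A \<Omega>; \<not> bounded \<Omega>; connected X; X \<subseteq> \<Omega>; X \<subseteq> cball c ((2 + 4 * C1) * s); 0 < s;
       x \<in> X; y \<in> X\<rbrakk> \<Longrightarrow> linked \<Omega> (real N2 * s) x y"
    by (rule linked_in_connected_region[of A "2 + 4 * C1"]) blast
  define C where "C = 8 * real N1 + A * real N2 + 2 * real N1 * (A + 1) + A + C1"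
  have C: "C \<ge> 1" "C1 \<le> 2 * C"
    using A C1 by (auto simp: C_def add_increasing)
  have key: "inner_uniform (2 * C) (- E)"
    if iu: "inner_uniform A \<Omega>" and cpt: "compact (- \<Omega>)" and E: "closed E" "E \<subseteq> - \<Omega>"
      and comps: "\<And>S. S \<in> components (- \<Omega>) \<Longrightarrow> S \<inter> E \<noteq> {} \<Longrightarrow> S \<subseteq> E"
      and small: "\<And>S x y e. S \<in> components (- \<Omega>) \<Longrightarrow> S \<inter> E = {} \<Longrightarrow> x \<in> S \<Longrightarrow> y \<in> S \<Longrightarrow> e \<in> E \<Longrightarrow> dist x y \<le> C1 * dist x e"
    for \<Omega> E
  proof (rule inner_uniformI[OF C(1)])
    have \<Omega>: "open \<Omega>" "connected \<Omega>" "\<Omega> \<noteq> {}"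
      using iu by (auto simp: inner_uniform_def plane_domain_def)
    have unb: "\<not> bounded \<Omega>"
      using cpt compact_imp_bounded[OF cpt] bounded_Un[of \<Omega> "- \<Omega>"] by (auto simp: Un_commute)
    have "connected (- E)"
      by (rule connected_complement_of_components[of "- \<Omega>"]) (use \<Omega> E comps in auto)
    then show "plane_domain (- E)"
      using E \<Omega> by (auto simp: plane_domain_def)
    fix a b L assume "a \<noteq> b" "linked (- E) L a b" and L: "0 < L"
    then obtain \<sigma> where \<sigma>: "joins_in (- E) a b \<sigma>" "curve_length \<sigma> 0 1 \<le> ennreal L"
      unfolding linked_def by blast
    define X where "X = path_image \<sigma>"
    have X: "compact X" "connected X" "a \<in> X" "b \<in> X" "X \<subseteq> - E" "X \<subseteq> cball a L"
      using \<sigma>(1) path_image_subset_cball[OF \<sigma>] L pathstart_in_path_image[of \<sigma>] pathfinish_in_path_image[of \<sigma>]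
      by (auto simp: X_def joins_in_def compact_path_image connected_path_image)
    show "\<exists>\<gamma>. joins_in (- E) a b \<gamma> \<and> curve_length \<gamma> 0 1 \<le> ennreal (C * L) \<and>
        (\<forall>t\<in>{0..1}. \<forall>e. e \<notin> - E \<longrightarrow> curve_length \<gamma> 0 t \<le> ennreal (C * dist (\<gamma> t) e) \<or>
                                     curve_length \<gamma> t 1 \<le> ennreal (C * dist (\<gamma> t) e))"
    proof (cases "\<exists>x\<in>X. \<forall>e\<in>E. 4 * L \<le> dist x e")
      case True
      then obtain x where x: "x \<in> X" "\<And>e. e \<in> E \<Longrightarrow> 4 * L \<le> dist x e" by blast
      have ab: "dist a b \<le> L"
        using X(4,6) by auto
      have "a \<in> cball x (2 * L)" "b \<in> cball x (2 * L)"
      proof -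
        have "dist x a \<le> L" using x(1) X(6) by (auto simp: dist_commute)
        then show "a \<in> cball x (2 * L)" "b \<in> cball x (2 * L)"
          using ab L dist_triangle[of x b a] by auto
      qed
      then have "closed_segment a b \<subseteq> cball x (2 * L)"
        by (intro closed_segment_subset) auto
      then have far: "2 * L \<le> dist p e" if "p \<in> closed_segment a b" "e \<in> E" for p e
        using that x(2)[OF that(2)] dist_triangle[of x e p] by fastforce
      have len: "curve_length (linepath a b) 0 t \<le> ennreal L" if "t \<in> {0..1}" for t
      proof -
        have "t * dist a b \<le> 1 * dist a b"
          using that by (intro mult_right_mono) auto
        then show ?thesis
          using curve_length_linepath[of 0 t a b] ab that by (auto intro: order_trans ennreal_leI)
      qed
      have "L \<le> C * dist (linepath a b t) e" if t: "t \<in> {0..1}" and e: "e \<in> E" for t e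
      proof -
        have "linepath a b t \<in> closed_segment a b"
          using t linepath_in_path by blast
        from far[OF this e] have "L \<le> 1 * dist (linepath a b t) e" using L by simp
        also have "\<dots> \<le> C * dist (linepath a b t) e"
          using C by (intro mult_right_mono) auto
        finally show ?thesis .
      qed
      then have "\<forall>t\<in>{0..1}. \<forall>e. e \<notin> - E \<longrightarrow> curve_length (linepath a b) 0 t \<le> ennreal (C * dist (linepath a b t) e)"
        using len by (meson ComplI ennreal_leI order_trans)
      moreover have "L \<le> C * L"
        using C L by simp
      then have "curve_length (linepath a b) 0 1 \<le> ennreal (C * L)"
        using len[of 1] by (auto intro: order_trans ennreal_leI)
      moreover have "joins_in (- E) a b (linepath a b)"
        using far L by (fastforce simp: joins_in_def)
      ultimately show ?thesis by blast
    next
      case False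
      then have near: "\<exists>e\<in>E. dist x e < 4 * L" if "x \<in> X" for x
        using that by (force simp: not_le)
      define B where "B = ball a ((2 + 4 * C1) * L)"
      have inB: "S \<subseteq> B" if S: "S \<in> components (- \<Omega>)" "S \<inter> X \<noteq> {}" for S
      proof
        fix y assume y: "y \<in> S"
        obtain x where x: "x \<in> S" "x \<in> X" using S(2) by blast
        have "S \<inter> E = {}"
          using comps[OF S(1)] x X(5) by blast
        obtain e where e: "e \<in> E" "dist x e < 4 * L"
          using near[OF x(2)] by blast
        have "dist x y \<le> C1 * dist x e"
          using small[OF S(1) \<open>S \<inter> E = {}\<close> x(1) y e(1)] .
        also have "\<dots> \<le> C1 * (4 * L)"
          using e(2) C1 by (intro mult_left_mono) auto
        finally show "y \<in> B"
          using x(2) X(6) L dist_triangle[of a y x] by (force simp: B_def algebra_simps)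
      qed
      have "1 * L < (2 + 4 * C1) * L"
        using L C1 by (intro mult_strict_right_mono) auto
      then have "X \<subseteq> B"
        using X(6) by (auto simp: B_def)
      then obtain Y where Y: "open Y" "X \<subseteq> Y" "Y \<subseteq> B" "connected (Y - (- \<Omega>))"
          "\<And>S. S \<in> components (- \<Omega>) \<Longrightarrow> S \<inter> Y \<noteq> {} \<Longrightarrow> S \<subseteq> Y"
        using connected_neighbourhood_minus_compact[OF cpt _ X(1,2) _ _ _ inB] \<Omega> X(3) unfolding B_def
        by (metis double_complement empty_iff open_ball)
      \<comment> \<open>Starting at a point of a filled component, move a distance comparable to the distance \<open>D\<close>
        of this component from \<open>E\<close> to get to \<open>\<Omega> \<inter> Y\<close>.\<close>
      define U where "U D = {z. \<forall>e\<in>E. 3 / 4 * D \<le> dist z e} \<inter> - E" for D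
      have escape: "\<exists>y D. y \<in> \<Omega> \<inter> Y \<and> 0 \<le> D \<and> D \<le> 4 * L \<and> linked (U D) (real N1 * D) p y" if p: "p \<in> X" for p
      proof (cases "p \<in> \<Omega>")
        case True
        then have "linked (U 0) (real N1 * 0) p p"
          using E by (intro linked_refl) (auto simp: U_def)
        then show ?thesis
          using True p Y(2) L by (intro exI[of _ p] exI[of _ 0]) auto
      next
        case False
        define S where "S = connected_component_set (- \<Omega>) p"
        have S: "S \<in> components (- \<Omega>)" "p \<in> S"
          unfolding S_def using False by (auto intro: componentsI)
        have SE: "S \<inter> E = {}"
          using comps[OF S(1)] S(2) p X(5) by blast
        obtain e0 where e0: "e0 \<in> E" "dist p e0 < 4 * L"
          using near[OF p] by blast
        have Sc: "compact S" "connected S" "S \<noteq> {}"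
          using S cpt compact_components in_components_connected by auto
        define D where "D = setdist S E"
        have "0 < D"
          unfolding D_def using Sc E(1) SE e0(1) setdist_gt_0_compact_closed by blast
        have De: "D \<le> dist x e" if "x \<in> S" "e \<in> E" for x e
          unfolding D_def using that by (rule setdist_le_dist)
        have diam: "dist x y \<le> 2 * C1 * D" if xy: "x \<in> S" "y \<in> S" for x y
        proof -
          have "dist x y / (2 * C1) \<le> D"
            unfolding D_def
          proof (rule le_setdistI)
            fix x' e assume xe: "x' \<in> S" "e \<in> E"
            have "dist x y \<le> C1 * dist x' e + C1 * dist x' e"
              using small[OF S(1) SE xe(1) xy(1) xe(2)] small[OF S(1) SE xe(1) xy(2) xe(2)]
                dist_triangle3[of x y x'] by linarith
            then show "dist x y / (2 * C1) \<le> dist x' e"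
              using C1 by (simp add: field_simps)
          qed (use Sc e0 in auto)
          then show ?thesis
            using C1 by (simp add: field_simps)
        qed
        have "S \<subseteq> Y"
          using Y(5)[OF S(1)] S(2) p Y(2) by blast
        have "S \<noteq> UNIV"
          using in_components_subset[OF S(1)] \<Omega>(3) by auto
        then obtain w where w: "w \<in> frontier S"
          using frontier_eq_empty[of S] Sc(3) by blast
        then have "w \<in> S"
          using Sc(1) by (auto simp: frontier_def closure_closed compact_imp_closed)
        then obtain \<epsilon> where \<epsilon>: "\<epsilon> > 0" "ball w \<epsilon> \<subseteq> Y"
          using Y(1) \<open>S \<subseteq> Y\<close> open_contains_ball by blast
        define \<eta> where "\<eta> = min \<epsilon> (D / 4)"
        have \<eta>: "\<eta> > 0" "ball w \<eta> \<subseteq> ball w \<epsilon>" "\<eta> \<le> D / 4"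
          using \<epsilon> \<open>0 < D\<close> by (auto simp: \<eta>_def)
        have "\<not> ball w \<eta> \<subseteq> - \<Omega>"
        proof
          assume "ball w \<eta> \<subseteq> - \<Omega>"
          then have "ball w \<eta> \<subseteq> S"
            using \<open>w \<in> S\<close> \<eta>(1) by (intro components_maximal[OF S(1)]) auto
          then have "w \<in> interior S"
            using \<eta>(1) by (meson centre_in_ball interior_maximal open_ball subsetD)
          then show False
            using w by (auto simp: frontier_def)
        qed
        then obtain y where y: "y \<in> ball w \<eta>" "y \<in> \<Omega>" by blast
        have "linked {z. \<forall>e\<in>E. 3 / 4 * D \<le> dist z e} (real N1 * D) p y"
          by (rule N1[OF Sc(2) \<open>0 < D\<close> De diam S(2) \<open>w \<in> S\<close>]) (use y \<eta> in auto)
        moreover have "{z. \<forall>e\<in>E. 3 / 4 * D \<le> dist z e} \<subseteq> U D"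
          using \<open>0 < D\<close> by (auto simp: U_def)
        ultimately have "linked (U D) (real N1 * D) p y"
          by (elim linked_mono) auto
        moreover have "D \<le> 4 * L"
          using De[OF S(2) e0(1)] e0(2) by simp
        ultimately show ?thesis
          using y \<eta>(2) \<epsilon>(2) \<open>0 < D\<close> by (intro exI[of _ y] exI[of _ D]) auto
      qed
      obtain y D where y: "y \<in> \<Omega> \<inter> Y" and D: "0 \<le> D" "D \<le> 4 * L" and "linked (U D) (real N1 * D) a y"
        using escape[OF X(3)] by blast
      then obtain \<alpha> where \<alpha>: "joins_in (U D) a y \<alpha>" "curve_length \<alpha> 0 1 \<le> ennreal (real N1 * D)"
        unfolding linked_def by blast
      obtain y' D' where y': "y' \<in> \<Omega> \<inter> Y" and D': "0 \<le> D'" "D' \<le> 4 * L" and "linked (U D') (real N1 * D') b y'"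
        using escape[OF X(4)] by blast
      then obtain \<beta> where \<beta>: "joins_in (U D') y' b \<beta>" "curve_length \<beta> 0 1 \<le> ennreal (real N1 * D')"
        using linked_sym unfolding linked_def by blast
      have "linked \<Omega> (real N2 * L) y y'"
      proof (rule N2[OF iu unb _ _ _ L])
        show "connected (\<Omega> \<inter> Y)"
          using Y(4) by (simp add: Diff_eq Int_commute)
        show "\<Omega> \<inter> Y \<subseteq> cball a ((2 + 4 * C1) * L)"
          using Y(3) by (auto simp: B_def)
      qed (use y y' in auto)
      then obtain \<gamma> where \<gamma>: "joins_in \<Omega> y y' \<gamma>" "curve_length \<gamma> 0 1 \<le> ennreal (A * (real N2 * L))"
        "\<And>t e. t \<in> {0..1} \<Longrightarrow> e \<notin> \<Omega> \<Longrightarrow>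
          curve_length \<gamma> 0 t \<le> ennreal (A * dist (\<gamma> t) e) \<or> curve_length \<gamma> t 1 \<le> ennreal (A * dist (\<gamma> t) e)"
        using inner_uniform_curve[OF iu] L by (metis mult_nonneg_nonneg of_nat_0_le_iff less_imp_le)
      define \<Gamma> where "\<Gamma> = \<alpha> +++ (\<gamma> +++ \<beta>)"
      have fin: "pathfinish \<gamma> = pathstart \<beta>" "pathfinish \<alpha> = pathstart (\<gamma> +++ \<beta>)"
        using \<alpha>(1) \<beta>(1) \<gamma>(1) by (auto simp: joins_in_def)
      have "joins_in (- E) a b \<Gamma>"
        unfolding \<Gamma>_def
        by (intro joins_in_join[of _ _ y] joins_in_join[of _ _ y'])
           (use \<alpha>(1) \<beta>(1) \<gamma>(1) E(2) in \<open>auto simp: joins_in_def U_def\<close>)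
      moreover have "curve_length \<Gamma> 0 1 \<le> ennreal (C * L)"
      proof -
        have "curve_length \<Gamma> 0 1 \<le> curve_length \<alpha> 0 1 + (curve_length \<gamma> 0 1 + curve_length \<beta> 0 1)"
          unfolding \<Gamma>_def using curve_length_join_le[OF fin(2)] curve_length_join_le[OF fin(1)]
          by (meson add_left_mono order_trans)
        also have "\<dots> \<le> ennreal (real N1 * D) + (ennreal (A * (real N2 * L)) + ennreal (real N1 * D'))"
          using \<alpha>(2) \<beta>(2) \<gamma>(2) by (intro add_mono)
        also have "\<dots> = ennreal (real N1 * D + (A * (real N2 * L) + real N1 * D'))"
          using D D' A L by (simp add: ennreal_plus)
        also have "\<dots> \<le> ennreal (C * L)"
        proof (rule ennreal_leI)
          have "real N1 * D \<le> real N1 * (4 * L)" "real N1 * D' \<le> real N1 * (4 * L)"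
            using D D' by (auto intro: mult_left_mono)
          moreover have "0 \<le> 2 * real N1 * (A + 1) * L" "0 \<le> A * L" "0 \<le> C1 * L"
            using A C1 L by auto
          ultimately show "real N1 * D + (A * (real N2 * L) + real N1 * D') \<le> C * L"
            unfolding C_def distrib_right by linarith
        qed
        finally show ?thesis .
      qed
      moreover have "curve_length \<Gamma> 0 t \<le> ennreal (C * dist (\<Gamma> t) e) \<or> curve_length \<Gamma> t 1 \<le> ennreal (C * dist (\<Gamma> t) e)"
        if t: "t \<in> {0..1}" and e: "e \<in> E" for t e
      proof -
        have CU: "real N1 * d \<le> C * dist p e" if "p \<in> U d" "0 \<le> d" for p d
        proof -
          have "3 / 4 * d \<le> dist p e"
            using that(1) e by (auto simp: U_def)
          then have "real N1 * d \<le> real N1 * (2 * dist p e)"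
            using that(2) by (intro mult_left_mono) auto
          also have "\<dots> \<le> C * dist p e"
            using A C1 by (simp add: C_def algebra_simps add_increasing)
          finally show ?thesis .
        qed
        \<comment> \<open>\<open>p\<close> is a point of \<open>\<gamma>\<close> and \<open>q\<close> the endpoint \<open>y\<close> or \<open>y'\<close> that is close to it.\<close>
        have C\<gamma>: "real N1 * d + A * dist p e \<le> C * dist p e" if q: "q \<in> U d" "dist q p \<le> A * dist p e" for p q d
        proof -
          have "3 / 4 * d \<le> (A + 1) * dist p e"
            using q e dist_triangle[of q e p] by (auto simp: U_def distrib_right)
          moreover have "0 \<le> (A + 1) * dist p e"
            using A by simp
          ultimately have "d \<le> 2 * ((A + 1) * dist p e)"
            by linarith
          then have "real N1 * d \<le> real N1 * (2 * ((A + 1) * dist p e))"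
            by (intro mult_left_mono) auto
          moreover have "real N1 * (2 * ((A + 1) * dist p e)) = 2 * real N1 * (A + 1) * dist p e"
            by simp
          moreover have "0 \<le> 8 * real N1 * dist p e" "0 \<le> A * real N2 * dist p e" "0 \<le> C1 * dist p e"
            using A C1 by auto
          moreover have "C * dist p e = 8 * real N1 * dist p e + A * real N2 * dist p e
              + 2 * real N1 * (A + 1) * dist p e + A * dist p e + C1 * dist p e"
            unfolding C_def by (simp only: distrib_right)
          ultimately show ?thesis by linarith
        qed
        have mem: "\<alpha> u \<in> U D" "\<beta> u \<in> U D'" if "u \<in> {0..1}" for u
          using that \<alpha>(1) \<beta>(1) by (auto simp: joins_in_def path_image_def)
        have ends: "y \<in> U D" "y' \<in> U D'"
          using \<alpha>(1) \<beta>(1) unfolding joins_in_def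
          by (metis pathfinish_in_path_image pathstart_in_path_image subsetD)+
        show ?thesis
        proof (rule curve_length_join_cases[OF fin(2) t])
          fix u assume u: "u \<in> {0..1}" "(\<alpha> +++ \<gamma> +++ \<beta>) t = \<alpha> u" "curve_length (\<alpha> +++ \<gamma> +++ \<beta>) 0 t \<le> curve_length \<alpha> 0 u"
          have "curve_length \<Gamma> 0 t \<le> curve_length \<alpha> 0 1"
            using u curve_length_mono[of 0 0 u 1 \<alpha>] by (auto simp: \<Gamma>_def)
          also have "\<dots> \<le> ennreal (C * dist (\<Gamma> t) e)"
            using \<alpha>(2) ennreal_leI[OF CU[OF mem(1)[OF u(1)] D(1)]] u(2) by (auto simp: \<Gamma>_def)
          finally show ?thesis by blast
        next
          fix u assume u: "u \<in> {0..1}" "(\<alpha> +++ \<gamma> +++ \<beta>) t = (\<gamma> +++ \<beta>) u"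
            "curve_length (\<alpha> +++ \<gamma> +++ \<beta>) 0 t \<le> curve_length \<alpha> 0 1 + curve_length (\<gamma> +++ \<beta>) 0 u"
            "curve_length (\<alpha> +++ \<gamma> +++ \<beta>) t 1 \<le> curve_length (\<gamma> +++ \<beta>) u 1"
          show ?thesis
          proof (rule curve_length_join_cases[OF fin(1) u(1)])
            fix v assume v: "v \<in> {0..1}" "(\<gamma> +++ \<beta>) u = \<beta> v" "curve_length (\<gamma> +++ \<beta>) u 1 \<le> curve_length \<beta> v 1"
            have "curve_length \<Gamma> t 1 \<le> curve_length \<beta> 0 1"
              using u v curve_length_mono[of 0 v 1 1 \<beta>] by (auto simp: \<Gamma>_def)
            also have "\<dots> \<le> ennreal (C * dist (\<Gamma> t) e)"
              using \<beta>(2) ennreal_leI[OF CU[OF mem(2)[OF v(1)] D'(1)]] u(2) v(2) by (auto simp: \<Gamma>_def)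
            finally show ?thesis by blast
          next
            fix v assume v: "v \<in> {0..1}" "(\<gamma> +++ \<beta>) u = \<gamma> v" "curve_length (\<gamma> +++ \<beta>) 0 u \<le> curve_length \<gamma> 0 v"
              "curve_length (\<gamma> +++ \<beta>) u 1 \<le> curve_length \<gamma> v 1 + curve_length \<beta> 0 1"
            have \<Gamma>t: "\<Gamma> t = \<gamma> v"
              using u(2) v(2) by (simp add: \<Gamma>_def)
            have Ad: "0 \<le> A * dist (\<gamma> v) e" using A by simp
            have "e \<notin> \<Omega>" using e E(2) by auto
            from \<gamma>(3)[OF v(1) this] show ?thesis
            proof
              assume *: "curve_length \<gamma> 0 v \<le> ennreal (A * dist (\<gamma> v) e)"
              have "curve_length \<Gamma> 0 t \<le> curve_length \<alpha> 0 1 + curve_length \<gamma> 0 v"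
                unfolding \<Gamma>_def using u(3) v(3) by (meson add_left_mono order_trans)
              also have "\<dots> \<le> ennreal (real N1 * D) + ennreal (A * dist (\<gamma> v) e)"
                using \<alpha>(2) * by (rule add_mono)
              also have "\<dots> = ennreal (real N1 * D + A * dist (\<gamma> v) e)"
                using D(1) Ad by (simp add: ennreal_plus)
              also have "\<dots> \<le> ennreal (C * dist (\<Gamma> t) e)"
                unfolding \<Gamma>t using C\<gamma>[OF ends(1) dist_start_le_curve_length[OF \<gamma>(1) v(1) * Ad]] by (rule ennreal_leI)
              finally show ?thesis by blast
            next
              assume *: "curve_length \<gamma> v 1 \<le> ennreal (A * dist (\<gamma> v) e)"
              have "curve_length \<Gamma> t 1 \<le> curve_length \<gamma> v 1 + curve_length \<beta> 0 1"
                unfolding \<Gamma>_def using u(4) v(4) by (meson order_trans)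
              also have "\<dots> \<le> ennreal (A * dist (\<gamma> v) e) + ennreal (real N1 * D')"
                using * \<beta>(2) by (rule add_mono)
              also have "\<dots> = ennreal (real N1 * D' + A * dist (\<gamma> v) e)"
                using D'(1) Ad by (simp add: ennreal_plus add.commute)
              also have "\<dots> \<le> ennreal (C * dist (\<Gamma> t) e)"
                unfolding \<Gamma>t using C\<gamma>[OF ends(2), of "\<gamma> v"] dist_finish_le_curve_length[OF \<gamma>(1) v(1) * Ad]
                by (intro ennreal_leI) (simp add: dist_commute)
              finally show ?thesis by blast
            qed
          qed
        qed
      qed
      ultimately show ?thesis by (intro exI[of _ \<Gamma>]) auto
    qed
  qed
  show thesis
    by (rule that[OF C(2)]) (fact key)
qed


section \<open>The three properties of complementary components\<close>

theorem theorem1p3: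
  fixes A :: real
  assumes "A \<ge> 1"
  shows "\<exists>C::real. C \<ge> 1 \<and>
    (\<forall>\<Omega> :: complex set. inner_uniform A \<Omega> \<longrightarrow>
      (\<forall>S\<^sub>1\<in>components (- \<Omega>). \<forall>S\<^sub>2\<in>components (- \<Omega>). S\<^sub>1 \<noteq> S\<^sub>2 \<longrightarrow>
         min (ediameter S\<^sub>1) (ediameter S\<^sub>2) \<le> ennreal C * ennreal (setdist S\<^sub>1 S\<^sub>2)) \<and>
      (\<forall>S\<in>components (- \<Omega>). bounded_turning C S) \<and>
      ((\<exists>U. neighborhood_of_infinity U \<and> U \<subseteq> \<Omega>) \<longrightarrow>
         (\<exists>\<Omega>' :: nat \<Rightarrow> complex set.
            (\<forall>n. finitely_connected_domain (\<Omega>' n) \<and> inner_uniform C (\<Omega>' n) \<and>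
                 \<Omega> \<subseteq> \<Omega>' (Suc n) \<and> \<Omega>' (Suc n) \<subseteq> \<Omega>' n) \<and>
            totally_disconnected ((\<Inter>n. \<Omega>' n) - \<Omega>))))"
proof -
  define C1 where "C1 = 16 * A * (A + 1)^2"
  have "1 * 1 \<le> A * (A + 1)^2"
    using assms by (intro mult_mono one_le_power) auto
  then have C1: "C1 \<ge> 1"
    by (simp add: C1_def)
  obtain C where C: "C \<ge> C1" and fill:
    "\<And>\<Omega> E. \<lbrakk>inner_uniform A \<Omega>; compact (- \<Omega>); closed E; E \<subseteq> - \<Omega>;
      \<And>S. S \<in> components (- \<Omega>) \<Longrightarrow> S \<inter> E \<noteq> {} \<Longrightarrow> S \<subseteq> E;
      \<And>S x y e. S \<in> components (- \<Omega>) \<Longrightarrow> S \<inter> E = {} \<Longrightarrow> x \<in> S \<Longrightarrow> y \<in> S \<Longrightarrow> e \<in> E \<Longrightarrow> dist x y \<le> C1 * dist x e\<rbrakk>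
      \<Longrightarrow> inner_uniform C (- E)"
    by (rule inner_uniform_filled[OF assms C1]) blast
  show ?thesis
  proof (intro exI[of _ C] conjI allI impI ballI)
    show "1 \<le> C"
      using C C1 by simp
  next
    fix \<Omega> S1 S2
    assume iu: "inner_uniform A \<Omega>" and S: "S1 \<in> components (- \<Omega>)" "S2 \<in> components (- \<Omega>)" "S1 \<noteq> S2"
    have ne: "S1 \<noteq> {}" "S2 \<noteq> {}"
      using S in_components_nonempty by auto
    have sep: "min (ediameter S1) (ediameter S2) \<le> ennreal (C1 * dist x y)" if "x \<in> S1" "y \<in> S2" for x y
      unfolding C1_def by (rule components_relatively_separated[OF iu S that])
    obtain m where m: "min (ediameter S1) (ediameter S2) = ennreal m" "0 \<le> m"
      using sep ne by (metis ennreal_cases ennreal_less_top leD ex_in_conv)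
    have "m / C1 \<le> setdist S1 S2"
    proof (rule le_setdistI[OF ne])
      fix x y assume "x \<in> S1" "y \<in> S2"
      then have "m \<le> C1 * dist x y"
        using sep m C1 by (metis ennreal_le_iff mult_nonneg_nonneg order_trans zero_le_dist zero_le_one)
      then show "m / C1 \<le> dist x y"
        using C1 by (simp add: field_simps)
    qed
    then have "m \<le> C1 * setdist S1 S2"
      using C1 by (simp add: field_simps)
    also have "\<dots> \<le> C * setdist S1 S2"
      using C by (intro mult_right_mono) auto
    finally show "min (ediameter S1) (ediameter S2) \<le> ennreal C * ennreal (setdist S1 S2)"
      using m C C1 by (simp add: ennreal_mult[symmetric] ennreal_leI)
  next
    fix \<Omega> S assume iu: "inner_uniform A \<Omega>" and S: "S \<in> components (- \<Omega>)"
    have "bounded_turning C1 S"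
      unfolding C1_def using component_bounded_turning[OF iu S] .
    moreover have "ennreal C1 * ennreal (dist x y) \<le> ennreal C * ennreal (dist x y)" for x y :: complex
      using C by (intro mult_right_mono ennreal_leI) auto
    ultimately show "bounded_turning C S"
      unfolding bounded_turning_def using C by (meson order_trans)
  next
    fix \<Omega> assume iu: "inner_uniform A \<Omega>" and inf: "\<exists>U. neighborhood_of_infinity U \<and> U \<subseteq> \<Omega>"
    have \<Omega>: "open \<Omega>" "connected \<Omega>" "\<Omega> \<noteq> {}"
      using iu by (auto simp: inner_uniform_def plane_domain_def)
    obtain c r where "- cball c r \<subseteq> \<Omega>"
      using inf by (auto simp: neighborhood_of_infinity_def)
    then have "- \<Omega> \<subseteq> cball c r" by auto
    then have cpt: "compact (- \<Omega>)"
      using \<Omega>(1) by (meson bounded_cball bounded_subset closed_Compl compact_eq_bounded_closed)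
    \<comment> \<open>\<open>E n\<close> is the complement of the \<open>n\<close>-th approximating domain.\<close>
    define F where "F n = {S \<in> components (- \<Omega>). ennreal (1 / real (Suc n)) \<le> ediameter S}" for n
    define E where "E n = \<Union>(F n)" for n
    have fin: "finite (F n)" for n
      unfolding F_def by (rule finite_large_components[OF iu cpt]) simp
    have clE: "closed (E n)" for n
      unfolding E_def using fin closed_components[of "- \<Omega>"] \<Omega>(1) by (intro closed_Union) (auto simp: F_def)
    have subE: "E n \<subseteq> - \<Omega>" for n
      unfolding E_def F_def using in_components_subset by blast
    have F_disj: "S \<in> F n" if S: "S \<in> components (- \<Omega>)" "S \<inter> E n \<noteq> {}" for S n
    proof -
      obtain T where "T \<in> F n" "S \<inter> T \<noteq> {}"
        using S(2) by (auto simp: E_def)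
      then show ?thesis
        using S(1) components_eq[of S "- \<Omega>" T] by (auto simp: F_def)
    qed
    have iuE: "inner_uniform C (- E n)" for n
    proof (rule fill[OF iu cpt clE subE])
      show "S \<subseteq> E n" if "S \<in> components (- \<Omega>)" "S \<inter> E n \<noteq> {}" for S
        using F_disj[OF that] by (auto simp: E_def)
      fix S x y e assume S: "S \<in> components (- \<Omega>)" "S \<inter> E n = {}" and xye: "x \<in> S" "y \<in> S" "e \<in> E n"
      obtain T where T: "T \<in> F n" "e \<in> T"
        using xye(3) by (auto simp: E_def)
      have "S \<notin> F n"
        using S(2) xye(1) by (auto simp: E_def)
      then have "S \<noteq> T" "ediameter S \<le> ediameter T"
        using T(1) S(1) by (auto simp: F_def not_le intro: less_imp_le order_trans)
      then have "ediameter S \<le> ennreal (C1 * dist x e)"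
        using components_relatively_separated[OF iu S(1) _ _ xye(1) T(2)] T(1)
        by (auto simp: F_def C1_def min_def)
      then have "ennreal (dist x y) \<le> ennreal (C1 * dist x e)"
        using dist_le_ediameter[OF xye(1,2)] by (rule order_trans[rotated])
      then show "dist x y \<le> C1 * dist x e"
        using C1 by simp
    qed
    have mono: "E n \<subseteq> E (Suc n)" for n
    proof -
      have "ennreal (1 / real (Suc (Suc n))) \<le> ennreal (1 / real (Suc n))"
        by (intro ennreal_leI) (simp add: field_simps)
      then show ?thesis
        unfolding E_def F_def by (blast intro: order_trans)
    qed
    have "finitely_connected_domain (- E n)" for n
    proof -
      have "finite (components (E n))"
        unfolding E_def using fin in_components_connected
        by (intro finite_components_Union_connected) (auto simp: F_def)
      then show ?thesis
        using iuE[of n] by (simp add: finitely_connected_domain_def inner_uniform_def)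
    qed
    moreover have "totally_disconnected ((\<Inter>n. - E n) - \<Omega>)"
      unfolding totally_disconnected_def
    proof (intro allI impI ballI)
      fix T x y assume T: "T \<subseteq> (\<Inter>n. - E n) - \<Omega>" "connected T" and xy: "x \<in> T" "y \<in> T"
      have "T \<subseteq> - \<Omega>" "- \<Omega> \<noteq> {}"
        using T(1) xy by auto
      then obtain S where S: "S \<in> components (- \<Omega>)" "T \<subseteq> S"
        using exists_component_superset T(2) by blast
      have "dist x y \<le> 1 / real (Suc n)" for n
      proof -
        have "S \<notin> F n"
          using S(2) xy(1) T(1) by (auto simp: E_def)
        then have "ediameter S < ennreal (1 / real (Suc n))"
          using S(1) by (auto simp: F_def not_le)
        then have "ennreal (dist x y) \<le> ennreal (1 / real (Suc n))"
          using dist_le_ediameter[of x S y] xy S(2) by (meson less_imp_le order_trans subsetD)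
        then show ?thesis
          by (subst (asm) ennreal_le_iff) auto
      qed
      then have "dist x y \<le> 0"
        using LIMSEQ_le_const[OF LIMSEQ_inverse_real_of_nat, of "dist x y"] by (auto simp: inverse_eq_divide)
      then show "x = y" by simp
    qed
    ultimately show "\<exists>\<Omega>'. (\<forall>n. finitely_connected_domain (\<Omega>' n) \<and> inner_uniform C (\<Omega>' n) \<and>
                 \<Omega> \<subseteq> \<Omega>' (Suc n) \<and> \<Omega>' (Suc n) \<subseteq> \<Omega>' n) \<and> totally_disconnected ((\<Inter>n. \<Omega>' n) - \<Omega>)"
      using iuE subE mono by (intro exI[of _ "\<lambda>n. - E n"]) blast
  qed
qed

end
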